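(* Let $K$ be a commutative ring with unit which is an integral domain, let $d\ge 1$, let $W\leq S_d$ be a permutation group with $|W|\in U(K)$, and let $\chi\colon W\to U(K)$ be a group homomorphism. Let $E$ be a free $K$-module with basis $(e_\ell)_{\ell\in L}$. Then the $d$-th semi-symmetric power $[\chi]^d(E)$ of weight $\chi$ is a free $K$-module with basis $$(e_{j_1}\chi\ldots\chi e_{j_d})_{(j_1,\ldots,j_d)\in J(\chi,T^d(E))}.$$
   Context: $U(K)$ is the group of units of $K$. $S_d$ acts on $T^d(E)$ by $\sigma(x_1\otimes\cdots\otimes x_d)=x_{\sigma^{-1}(1)}\otimes\cdots\otimes x_{\sigma^{-1}(d)}$. The $d$-th semi-symmetric power $[\chi]^d(E)$ is the quotient of $T^d(E)$ by the submodule generated by all $\chi(\sigma)^{-1}z-\sigma z$, $\sigma\in W$, $z\in T^d(E)$; the image of $x_1\otimes\cdots\otimes x_d$ is denoted $x_1\chi\ldots\chi x_d$, so that $x_{\sigma(1)}\chi\ldots\chi x_{\sigma(d)}=\chi(\sigma)x_1\chi\ldots\chi x_d$ for $\sigma\in W$. $W$ acts on $L^d$ by $(\sigma i)_t=i_{\sigma^{-1}(t)}$, and $W_i$ denotes the stabilizer of $i\in L^d$. $I(\chi,T^d(E))=\{i\in L^d\mid \chi=1\text{ on }W_i\}$ (a $W$-stable set), and $J(\chi,T^d(E))$ is a set consisting of exactly one element from each $W$-orbit contained in $I(\chi,T^d(E))$. *)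

theory Defs
  imports "HOL-Algebra.Module" "HOL-Algebra.AbelCoset" "HOL-Algebra.Group_Action" "HOL-Algebra.Sym_Groups"
begin

section \<open>Bases, generated submodules, free modules and quotient modules\<close>

definition submodule_span ::
  "('k, 'r) ring_scheme \<Rightarrow> ('k, 'e, 'm) module_scheme \<Rightarrow> 'e set \<Rightarrow> 'e set"
  where "submodule_span R M S = \<Inter> {N. submodule N R M \<and> S \<subseteq> N}"

definition lin_indep_family ::
  "('k, 'r) ring_scheme \<Rightarrow> ('k, 'e, 'm) module_scheme \<Rightarrow> 'i set \<Rightarrow> ('i \<Rightarrow> 'e) \<Rightarrow> bool"
  where "lin_indep_family R M I b \<longleftrightarrow>
    (\<forall>A c. finite A \<and> A \<subseteq> I \<and> c \<in> A \<rightarrow> carrier R \<and>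
       (\<Oplus>\<^bsub>M\<^esub> i \<in> A. c i \<odot>\<^bsub>M\<^esub> b i) = \<zero>\<^bsub>M\<^esub> \<longrightarrow> (\<forall>i\<in>A. c i = \<zero>\<^bsub>R\<^esub>))"

definition basis_family ::
  "('k, 'r) ring_scheme \<Rightarrow> ('k, 'e, 'm) module_scheme \<Rightarrow> 'i set \<Rightarrow> ('i \<Rightarrow> 'e) \<Rightarrow> bool"
  where "basis_family R M I b \<longleftrightarrow>
    b \<in> I \<rightarrow> carrier M \<and> lin_indep_family R M I b \<and> submodule_span R M (b ` I) = carrier M"

text \<open>The record type of modules extends that of rings, so a multiplication and a unit have to be
  supplied although no module notion refers to them.\<close>

definition free_module :: "('k, 'r) ring_scheme \<Rightarrow> 'x set \<Rightarrow> ('k, 'x \<Rightarrow> 'k) module"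
  where "free_module R X =
    \<lparr>carrier = {f \<in> X \<rightarrow>\<^sub>E carrier R. finite {x \<in> X. f x \<noteq> \<zero>\<^bsub>R\<^esub>}},
     monoid.mult = undefined, one = undefined,
     zero = (\<lambda>x\<in>X. \<zero>\<^bsub>R\<^esub>),
     add = (\<lambda>f g. \<lambda>x\<in>X. f x \<oplus>\<^bsub>R\<^esub> g x),
     smult = (\<lambda>a f. \<lambda>x\<in>X. a \<otimes>\<^bsub>R\<^esub> f x)\<rparr>"

definition free_gen :: "('k, 'r) ring_scheme \<Rightarrow> 'x set \<Rightarrow> 'x \<Rightarrow> ('x \<Rightarrow> 'k)"
  where "free_gen R X x = (\<lambda>y\<in>X. if y = x then \<one>\<^bsub>R\<^esub> else \<zero>\<^bsub>R\<^esub>)"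

definition quot_module :: "('k, 'e, 'm) module_scheme \<Rightarrow> 'e set \<Rightarrow> ('k, 'e set) module"
  where "quot_module M N =
    \<lparr>carrier = a_rcosets\<^bsub>M\<^esub> N,
     monoid.mult = undefined, one = undefined,
     zero = N,
     add = set_add M,
     smult = (\<lambda>a C. \<Union>x\<in>C. N +>\<^bsub>M\<^esub> (a \<odot>\<^bsub>M\<^esub> x))\<rparr>"


section \<open>Tensor powers\<close>

abbreviation tuples :: "nat \<Rightarrow> 'a set \<Rightarrow> (nat \<Rightarrow> 'a) set"
  where "tuples d A \<equiv> {1..d} \<rightarrow>\<^sub>E A"

text \<open>The action \<open>(\<sigma> x)\<^sub>t = x\<^bsub>\<sigma>\<inverse>(t)\<^esub>\<close> on \<open>d\<close>-tuples. Permutations fix all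
  numbers outside \<open>{1..d}\<close>, so extensionality is preserved.\<close>

definition perm_tuple :: "(nat \<Rightarrow> nat) \<Rightarrow> (nat \<Rightarrow> 'a) \<Rightarrow> (nat \<Rightarrow> 'a)"
  where "perm_tuple \<sigma> x = x \<circ> inv' \<sigma>"

definition multilinear_rels ::
  "('k, 'r) ring_scheme \<Rightarrow> ('k, 'e, 'm) module_scheme \<Rightarrow> nat \<Rightarrow> ((nat \<Rightarrow> 'e) \<Rightarrow> 'k) set"
  where "multilinear_rels R M d =
    (let X = tuples d (carrier M); F = free_module R X; g = free_gen R X in
      {g (x(t := u \<oplus>\<^bsub>M\<^esub> v)) \<ominus>\<^bsub>F\<^esub> (g (x(t := u)) \<oplus>\<^bsub>F\<^esub> g (x(t := v))) | x t u v.
         x \<in> X \<and> t \<in> {1..d} \<and> u \<in> carrier M \<and> v \<in> carrier M} \<union>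
      {g (x(t := a \<odot>\<^bsub>M\<^esub> u)) \<ominus>\<^bsub>F\<^esub> a \<odot>\<^bsub>F\<^esub> g (x(t := u)) | x t a u.
         x \<in> X \<and> t \<in> {1..d} \<and> a \<in> carrier R \<and> u \<in> carrier M})"

definition tensor_null ::
  "('k, 'r) ring_scheme \<Rightarrow> ('k, 'e, 'm) module_scheme \<Rightarrow> nat \<Rightarrow> ((nat \<Rightarrow> 'e) \<Rightarrow> 'k) set"
  where "tensor_null R M d =
    submodule_span R (free_module R (tuples d (carrier M))) (multilinear_rels R M d)"

definition tensor_power ::
  "('k, 'r) ring_scheme \<Rightarrow> ('k, 'e, 'm) module_scheme \<Rightarrow> nat \<Rightarrow>
    ('k, ((nat \<Rightarrow> 'e) \<Rightarrow> 'k) set) module"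
  where "tensor_power R M d =
    quot_module (free_module R (tuples d (carrier M))) (tensor_null R M d)"

definition tensor ::
  "('k, 'r) ring_scheme \<Rightarrow> ('k, 'e, 'm) module_scheme \<Rightarrow> nat \<Rightarrow> (nat \<Rightarrow> 'e) \<Rightarrow>
    ((nat \<Rightarrow> 'e) \<Rightarrow> 'k) set"
  where "tensor R M d x = tensor_null R M d
    +>\<^bsub>free_module R (tuples d (carrier M))\<^esub> free_gen R (tuples d (carrier M)) x"

text \<open>The linear extension of \<open>x \<mapsto> \<sigma> x\<close> to the free module is
  \<open>(\<sigma> f)(y) = f(\<sigma>\<inverse> y) = f(y \<circ> \<sigma>)\<close>; it preserves the multilinearity relations, so a
  permutation acts on the tensor power by taking images of cosets.
  See \<open>perm_tensor_tensor\<close>, \<open>perm_tensor_add\<close> and \<open>perm_tensor_smult\<close> below.\<close>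

definition perm_free :: "(nat \<Rightarrow> nat) \<Rightarrow> ((nat \<Rightarrow> 'e) \<Rightarrow> 'k) \<Rightarrow> ((nat \<Rightarrow> 'e) \<Rightarrow> 'k)"
  where "perm_free \<sigma> f = (\<lambda>y. f (y \<circ> \<sigma>))"

definition perm_tensor ::
  "(nat \<Rightarrow> nat) \<Rightarrow> ((nat \<Rightarrow> 'e) \<Rightarrow> 'k) set \<Rightarrow> ((nat \<Rightarrow> 'e) \<Rightarrow> 'k) set"
  where "perm_tensor \<sigma> z = perm_free \<sigma> ` z"


section \<open>Semi-symmetric powers\<close>

definition semi_sym_null ::
  "('k, 'r) ring_scheme \<Rightarrow> ('k, 'e, 'm) module_scheme \<Rightarrow> nat \<Rightarrow>
    (nat \<Rightarrow> nat) set \<Rightarrow> ((nat \<Rightarrow> nat) \<Rightarrow> 'k) \<Rightarrow> ((nat \<Rightarrow> 'e) \<Rightarrow> 'k) set set"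
  where "semi_sym_null R M d W \<chi> =
    (let T = tensor_power R M d in
      submodule_span R T
        {(inv\<^bsub>R\<^esub> (\<chi> \<sigma>)) \<odot>\<^bsub>T\<^esub> z \<ominus>\<^bsub>T\<^esub> perm_tensor \<sigma> z | \<sigma> z. \<sigma> \<in> W \<and> z \<in> carrier T})"

definition semi_sym_power ::
  "('k, 'r) ring_scheme \<Rightarrow> ('k, 'e, 'm) module_scheme \<Rightarrow> nat \<Rightarrow>
    (nat \<Rightarrow> nat) set \<Rightarrow> ((nat \<Rightarrow> nat) \<Rightarrow> 'k) \<Rightarrow>
    ('k, ((nat \<Rightarrow> 'e) \<Rightarrow> 'k) set set) module"
  where "semi_sym_power R M d W \<chi> =
    quot_module (tensor_power R M d) (semi_sym_null R M d W \<chi>)"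

text \<open>The element \<open>x\<^sub>1 \<chi> \<dots> \<chi> x\<^sub>d\<close>, the image of \<open>x\<^sub>1 \<otimes> \<dots> \<otimes> x\<^sub>d\<close>.\<close>

definition semi_sym_prod ::
  "('k, 'r) ring_scheme \<Rightarrow> ('k, 'e, 'm) module_scheme \<Rightarrow> nat \<Rightarrow>
    (nat \<Rightarrow> nat) set \<Rightarrow> ((nat \<Rightarrow> nat) \<Rightarrow> 'k) \<Rightarrow> (nat \<Rightarrow> 'e) \<Rightarrow>
    ((nat \<Rightarrow> 'e) \<Rightarrow> 'k) set set"
  where "semi_sym_prod R M d W \<chi> x =
    semi_sym_null R M d W \<chi> +>\<^bsub>tensor_power R M d\<^esub> tensor R M d x"


section \<open>Index sets\<close>

abbreviation perm_group :: "nat \<Rightarrow> (nat \<Rightarrow> nat) set \<Rightarrow> (nat \<Rightarrow> nat) monoid"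
  where "perm_group d W \<equiv> (sym_group d)\<lparr>carrier := W\<rparr>"

definition index_set ::
  "('k, 'r) ring_scheme \<Rightarrow> nat \<Rightarrow> (nat \<Rightarrow> nat) set \<Rightarrow> ((nat \<Rightarrow> nat) \<Rightarrow> 'k) \<Rightarrow> 'l set \<Rightarrow>
    (nat \<Rightarrow> 'l) set"
  where "index_set R d W \<chi> L =
    {i \<in> tuples d L. \<forall>\<sigma> \<in> stabilizer (perm_group d W) perm_tuple i. \<chi> \<sigma> = \<one>\<^bsub>R\<^esub>}"

definition index_transversal ::
  "('k, 'r) ring_scheme \<Rightarrow> nat \<Rightarrow> (nat \<Rightarrow> nat) set \<Rightarrow> ((nat \<Rightarrow> nat) \<Rightarrow> 'k) \<Rightarrow> 'l set \<Rightarrow>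
    (nat \<Rightarrow> 'l) set \<Rightarrow> bool"
  where "index_transversal R d W \<chi> L J \<longleftrightarrow>
    J \<subseteq> index_set R d W \<chi> L \<and>
    (\<forall>B \<in> orbits (perm_group d W) (tuples d L) perm_tuple.
       B \<subseteq> index_set R d W \<chi> L \<longrightarrow> (\<exists>!j. j \<in> J \<inter> B))"

section \<open>Well-definedness\<close>

lemma module_free_module:
  assumes "cring R"
  shows "module R (free_module R X)"
proof -
  interpret cring R by fact
  have fin: "finite {x \<in> X. h x \<noteq> \<zero>\<^bsub>R\<^esub>}"
    if "finite {x \<in> X. f x \<noteq> \<zero>\<^bsub>R\<^esub>}" "finite {x \<in> X. g x \<noteq> \<zero>\<^bsub>R\<^esub>}"
      "\<And>x. \<lbrakk>x \<in> X; f x = \<zero>\<^bsub>R\<^esub>; g x = \<zero>\<^bsub>R\<^esub>\<rbrakk> \<Longrightarrow> h x = \<zero>\<^bsub>R\<^esub>"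
    for f g h :: "_ \<Rightarrow> 'a"
    using that by (auto intro!: finite_subset[of "{x \<in> X. h x \<noteq> \<zero>\<^bsub>R\<^esub>}"
        "{x \<in> X. f x \<noteq> \<zero>\<^bsub>R\<^esub>} \<union> {x \<in> X. g x \<noteq> \<zero>\<^bsub>R\<^esub>}"])
  show ?thesis
  proof (rule moduleI)
    show "abelian_group (free_module R X)"
    proof (rule abelian_groupI)
      fix f assume f: "f \<in> carrier (free_module R X)"
      show "\<exists>g \<in> carrier (free_module R X).
          g \<oplus>\<^bsub>free_module R X\<^esub> f = \<zero>\<^bsub>free_module R X\<^esub>"
      proof (intro bexI)
        show "(\<lambda>x\<in>X. \<ominus>\<^bsub>R\<^esub> f x) \<oplus>\<^bsub>free_module R X\<^esub> f = \<zero>\<^bsub>free_module R X\<^esub>"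
          using f by (auto simp: free_module_def fun_eq_iff PiE_iff l_neg)
        show "(\<lambda>x\<in>X. \<ominus>\<^bsub>R\<^esub> f x) \<in> carrier (free_module R X)"
          using f by (auto simp: free_module_def PiE_iff cong: conj_cong intro: fin[of f f])
      qed
    next
      fix f g assume "f \<in> carrier (free_module R X)" "g \<in> carrier (free_module R X)"
      then show "f \<oplus>\<^bsub>free_module R X\<^esub> g \<in> carrier (free_module R X)"
        by (auto simp: free_module_def PiE_iff cong: conj_cong intro: fin[of f g])
    next
      fix f g h
      assume "f \<in> carrier (free_module R X)" "g \<in> carrier (free_module R X)"
        "h \<in> carrier (free_module R X)"
      then show "(f \<oplus>\<^bsub>free_module R X\<^esub> g) \<oplus>\<^bsub>free_module R X\<^esub> h =
          f \<oplus>\<^bsub>free_module R X\<^esub> (g \<oplus>\<^bsub>free_module R X\<^esub> h)"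
        by (auto simp: free_module_def fun_eq_iff PiE_iff a_assoc)
    next
      fix f g assume "f \<in> carrier (free_module R X)" "g \<in> carrier (free_module R X)"
      then show "f \<oplus>\<^bsub>free_module R X\<^esub> g = g \<oplus>\<^bsub>free_module R X\<^esub> f"
        by (auto simp: free_module_def fun_eq_iff PiE_iff intro: a_comm)
    next
      fix f assume "f \<in> carrier (free_module R X)"
      then show "\<zero>\<^bsub>free_module R X\<^esub> \<oplus>\<^bsub>free_module R X\<^esub> f = f"
        by (auto simp: free_module_def fun_eq_iff PiE_iff extensional_def)
    qed (auto simp: free_module_def)
  next
    fix a f assume "a \<in> carrier R" "f \<in> carrier (free_module R X)"
    then show "a \<odot>\<^bsub>free_module R X\<^esub> f \<in> carrier (free_module R X)"
      by (auto simp: free_module_def PiE_iff cong: conj_cong intro: fin[of f f])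
  next
    fix f assume "f \<in> carrier (free_module R X)"
    then show "\<one>\<^bsub>R\<^esub> \<odot>\<^bsub>free_module R X\<^esub> f = f"
      by (auto simp: free_module_def fun_eq_iff PiE_iff extensional_def)
  qed (use assms in \<open>auto simp: free_module_def fun_eq_iff PiE_iff l_distr r_distr m_assoc\<close>)
qed

lemma submodule_submodule_span:
  assumes "module R M" "S \<subseteq> carrier M"
  shows "submodule (submodule_span R M S) R M"
proof -
  interpret module R M by fact
  show ?thesis
    using submoduleE(1)[OF carrier_is_submodule] assms(2) carrier_is_submodule
    by (intro submoduleI)
      (auto simp: submodule_span_def intro: submoduleE
        dest: subgroup.one_closed[OF submodule.axioms(1)])
qed

lemma quot_module_smult:
  assumes "module R M" "submodule N R M" "a \<in> carrier R" "x \<in> carrier M"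
  shows "a \<odot>\<^bsub>quot_module M N\<^esub> (N +>\<^bsub>M\<^esub> x) = N +>\<^bsub>M\<^esub> (a \<odot>\<^bsub>M\<^esub> x)"
proof -
  interpret module R M by fact
  interpret N: submodule N R M by fact
  have sub: "additive_subgroup N M"
    by (rule additive_subgroup.intro) (rule N.subgroup_axioms)
  interpret N: abelian_subgroup N M
    by (rule abelian_subgroupI3[OF sub]) (rule module.axioms(2)[OF assms(1)])
  have "N +>\<^bsub>M\<^esub> (a \<odot>\<^bsub>M\<^esub> (n \<oplus>\<^bsub>M\<^esub> x)) = N +>\<^bsub>M\<^esub> (a \<odot>\<^bsub>M\<^esub> x)" if "n \<in> N" for n
  proof -
    have "a \<odot>\<^bsub>M\<^esub> (n \<oplus>\<^bsub>M\<^esub> x) \<in> N +>\<^bsub>M\<^esub> (a \<odot>\<^bsub>M\<^esub> x)"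
      using that assms(3,4) N.a_subset by (auto simp: a_r_coset_def' smult_r_distr)
    then show ?thesis
      using assms(3,4) N.a_repr_independence' by blast
  qed
  moreover have "x \<in> N +>\<^bsub>M\<^esub> x" using assms(4) by (rule N.a_rcos_self)
  ultimately show ?thesis
    by (force simp: quot_module_def a_r_coset_def'[of M N x])
qed

lemma module_quot_module:
  assumes "module R M" "submodule N R M"
  shows "module R (quot_module M N)"
proof -
  interpret module R M by fact
  interpret N: submodule N R M by fact
  have sub: "additive_subgroup N M"
    by (rule additive_subgroup.intro) (rule N.subgroup_axioms)
  interpret N: abelian_subgroup N M
    by (rule abelian_subgroupI3[OF sub]) (rule module.axioms(2)[OF assms(1)])
  have add: "(N +>\<^bsub>M\<^esub> x) \<oplus>\<^bsub>quot_module M N\<^esub> (N +>\<^bsub>M\<^esub> y) = N +>\<^bsub>M\<^esub> (x \<oplus>\<^bsub>M\<^esub> y)"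
    if "x \<in> carrier M" "y \<in> carrier M" for x y
    using that by (simp add: quot_module_def N.a_rcos_sum)
  have car: "carrier (quot_module M N) = (\<lambda>x. N +>\<^bsub>M\<^esub> x) ` carrier M"
    by (auto simp: quot_module_def A_RCOSETS_def')
  have zero: "\<zero>\<^bsub>quot_module M N\<^esub> = N +>\<^bsub>M\<^esub> \<zero>\<^bsub>M\<^esub>"
    using N.a_rcos_const[of "\<zero>\<^bsub>M\<^esub>"] by (simp add: quot_module_def)
  have ag: "abelian_group (quot_module M N)"
  proof (rule abelian_groupI)
    fix z assume "z \<in> carrier (quot_module M N)"
    then obtain x where x: "x \<in> carrier M" "z = N +>\<^bsub>M\<^esub> x" by (auto simp: car)
    then show "\<exists>y \<in> carrier (quot_module M N). y \<oplus>\<^bsub>quot_module M N\<^esub> z = \<zero>\<^bsub>quot_module M N\<^esub>"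
      by (intro bexI[of _ "N +>\<^bsub>M\<^esub> (\<ominus>\<^bsub>M\<^esub> x)"]) (auto simp: car add zero M.l_neg)
  qed (auto simp: car add zero M.a_ac)
  show ?thesis
    by (rule moduleI)
      (use ag in \<open>auto simp: car add quot_module_smult[OF assms] smult_l_distr smult_r_distr
         smult_assoc1 is_cring\<close>)
qed

lemma multilinear_rels_subset:
  assumes "module R M"
  shows "multilinear_rels R M d \<subseteq> carrier (free_module R (tuples d (carrier M)))"
proof -
  interpret module R M by fact
  interpret F: module R "free_module R (tuples d (carrier M))"
    by (rule module_free_module) (rule is_cring)
  have gen: "free_gen R (tuples d (carrier M)) x \<in> carrier (free_module R (tuples d (carrier M)))"
    for x
    by (auto simp: free_gen_def free_module_def)
  show ?thesis
    by (auto simp: multilinear_rels_def Let_def gen simp del: One_nat_def)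
qed

lemma submodule_tensor_null:
  "module R M \<Longrightarrow> submodule (tensor_null R M d) R (free_module R (tuples d (carrier M)))"
  unfolding tensor_null_def
  by (intro submodule_submodule_span module_free_module multilinear_rels_subset)
    (auto simp: module_def)

lemma module_tensor_power: "module R M \<Longrightarrow> module R (tensor_power R M d)"
  unfolding tensor_power_def
  by (intro module_quot_module module_free_module submodule_tensor_null) (auto simp: module_def)

lemma perm_tuple_in_tuples_iff:
  assumes "\<sigma> permutes {1..d}"
  shows "x \<circ> \<sigma> \<in> tuples d A \<longleftrightarrow> x \<in> tuples d A"
proof -
  have "(\<forall>t\<in>{1..d}. x (\<sigma> t) \<in> A) \<longleftrightarrow> (\<forall>t\<in>{1..d}. x t \<in> A)"
    using permutes_image[OF assms] by (metis (no_types, lifting) imageE imageI)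
  moreover have "(\<forall>t. t \<notin> {1..d} \<longrightarrow> x (\<sigma> t) = undefined) \<longleftrightarrow> (\<forall>t. t \<notin> {1..d} \<longrightarrow> x t = undefined)"
    using assms by (simp add: permutes_not_in del: atLeastAtMost_iff)
  ultimately show ?thesis
    by (simp add: PiE_iff extensional_def del: atLeastAtMost_iff)
qed

context
  notes One_nat_def [simp del]
  fixes R :: "('k, 'r) ring_scheme" and M :: "('k, 'e, 'm) module_scheme"
    and d :: nat and \<sigma> :: "nat \<Rightarrow> nat"
  assumes mod: "module R M" and perm: "\<sigma> permutes {1..d}"
begin

private abbreviation "TX \<equiv> tuples d (carrier M)"
private abbreviation "TF \<equiv> free_module R TX"

private lemma modF: "module R TF"
  using mod by (intro module_free_module) (simp add: module_def)

interpretation TF: module R TF by (rule modF)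

private lemma perm_free_closed:
  assumes "\<pi> permutes {1..d}" "f \<in> carrier TF"
  shows "perm_free \<pi> f \<in> carrier TF"
proof -
  have "{y \<in> TX. f (y \<circ> \<pi>) \<noteq> \<zero>\<^bsub>R\<^esub>} \<subseteq> (\<lambda>y. y \<circ> inv' \<pi>) ` {y \<in> TX. f y \<noteq> \<zero>\<^bsub>R\<^esub>}"
  proof
    fix y assume y: "y \<in> {y \<in> TX. f (y \<circ> \<pi>) \<noteq> \<zero>\<^bsub>R\<^esub>}"
    then have "y \<circ> \<pi> \<in> {y \<in> TX. f y \<noteq> \<zero>\<^bsub>R\<^esub>}"
      using perm_tuple_in_tuples_iff[OF assms(1), of y "carrier M"] by simp
    moreover have "y = (y \<circ> \<pi>) \<circ> inv' \<pi>"
      using permutes_inv_o(1)[OF assms(1)] by (metis comp_assoc comp_id)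
    ultimately show "y \<in> (\<lambda>y. y \<circ> inv' \<pi>) ` {y \<in> TX. f y \<noteq> \<zero>\<^bsub>R\<^esub>}"
      by (intro image_eqI)
  qed
  moreover have "finite {y \<in> TX. f y \<noteq> \<zero>\<^bsub>R\<^esub>}"
    using assms(2) by (simp add: free_module_def)
  ultimately have "finite {y \<in> TX. f (y \<circ> \<pi>) \<noteq> \<zero>\<^bsub>R\<^esub>}"
    using finite_subset by blast
  moreover have "(\<lambda>y. f (y \<circ> \<pi>)) \<in> TX \<rightarrow>\<^sub>E carrier R"
    using assms(2) perm_tuple_in_tuples_iff[OF assms(1), of _ "carrier M"]
    by (auto simp: free_module_def PiE_iff[of _ TX] extensional_def[of TX])
  ultimately show ?thesis
    by (simp add: perm_free_def free_module_def)
qed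

private lemma perm_free_add:
  "\<pi> permutes {1..d} \<Longrightarrow> perm_free \<pi> (f \<oplus>\<^bsub>TF\<^esub> g) = perm_free \<pi> f \<oplus>\<^bsub>TF\<^esub> perm_free \<pi> g"
  using perm_tuple_in_tuples_iff[of \<pi> d _ "carrier M"]
  by (auto simp: perm_free_def free_module_def fun_eq_iff restrict_def)

private lemma perm_free_smult:
  "\<pi> permutes {1..d} \<Longrightarrow> perm_free \<pi> (a \<odot>\<^bsub>TF\<^esub> f) = a \<odot>\<^bsub>TF\<^esub> perm_free \<pi> f"
  using perm_tuple_in_tuples_iff[of \<pi> d _ "carrier M"]
  by (auto simp: perm_free_def free_module_def fun_eq_iff restrict_def)

private lemma perm_free_uminus:
  assumes "\<pi> permutes {1..d}" "f \<in> carrier TF"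
  shows "perm_free \<pi> (\<ominus>\<^bsub>TF\<^esub> f) = \<ominus>\<^bsub>TF\<^esub> perm_free \<pi> f"
proof -
  have "\<ominus>\<^bsub>TF\<^esub> g = (\<ominus>\<^bsub>R\<^esub> \<one>\<^bsub>R\<^esub>) \<odot>\<^bsub>TF\<^esub> g" if "g \<in> carrier TF" for g
    using that by (simp add: TF.smult_l_minus)
  then show ?thesis
    using assms by (simp add: perm_free_smult perm_free_closed)
qed

private lemma perm_free_minus:
  assumes "\<pi> permutes {1..d}" "f \<in> carrier TF" "g \<in> carrier TF"
  shows "perm_free \<pi> (f \<ominus>\<^bsub>TF\<^esub> g) = perm_free \<pi> f \<ominus>\<^bsub>TF\<^esub> perm_free \<pi> g"
  using assms by (simp add: a_minus_def perm_free_add perm_free_uminus)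

private lemma free_gen_closed: "free_gen R TX x \<in> carrier TF"
  by (auto simp: free_gen_def free_module_def)

private lemma perm_free_gen:
  assumes "\<pi> permutes {1..d}"
  shows "perm_free \<pi> (free_gen R TX x) = free_gen R TX (perm_tuple \<pi> x)"
proof -
  have "y \<circ> \<pi> = x \<longleftrightarrow> y = x \<circ> inv' \<pi>" for y
    using permutes_inv_o[OF assms] by (metis comp_assoc comp_id)
  then show ?thesis
    using perm_tuple_in_tuples_iff[OF assms, of _ "carrier M"]
    by (auto simp: perm_free_def free_gen_def perm_tuple_def fun_eq_iff[of "perm_free _ _"] restrict_def)
qed

private lemma perm_tuple_upd:
  assumes "\<pi> permutes {1..d}"
  shows "perm_tuple \<pi> (x(t := u)) = (perm_tuple \<pi> x)(\<pi> t := u)"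
  using permutes_inverses[OF assms] by (force simp: perm_tuple_def fun_eq_iff)

private lemma perm_free_rels:
  assumes "\<pi> permutes {1..d}" "f \<in> multilinear_rels R M d"
  shows "perm_free \<pi> f \<in> multilinear_rels R M d"
proof -
  have pt: "perm_tuple \<pi> x \<in> TX" if "x \<in> TX" for x
    using that perm_tuple_in_tuples_iff[OF permutes_inv[OF assms(1)], of x "carrier M"]
    by (simp add: perm_tuple_def)
  have in_d: "\<pi> t \<in> {1..d}" if "t \<in> {1..d}" for t
    using that permutes_in_image[OF assms(1)] by blast
  note simps = perm_free_minus perm_free_add perm_free_smult perm_free_gen free_gen_closed
    perm_tuple_upd assms(1)
  from assms(2) consider
    (add) x t u v where "x \<in> TX" "t \<in> {1..d}" "u \<in> carrier M" "v \<in> carrier M"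
      "f = free_gen R TX (x(t := u \<oplus>\<^bsub>M\<^esub> v)) \<ominus>\<^bsub>TF\<^esub>
        (free_gen R TX (x(t := u)) \<oplus>\<^bsub>TF\<^esub> free_gen R TX (x(t := v)))"
  | (smult) x t a u where "x \<in> TX" "t \<in> {1..d}" "a \<in> carrier R" "u \<in> carrier M"
      "f = free_gen R TX (x(t := a \<odot>\<^bsub>M\<^esub> u)) \<ominus>\<^bsub>TF\<^esub> a \<odot>\<^bsub>TF\<^esub> free_gen R TX (x(t := u))"
    unfolding multilinear_rels_def Let_def by blast
  then show ?thesis
  proof cases
    case add
    have "perm_free \<pi> f = free_gen R TX ((perm_tuple \<pi> x)(\<pi> t := u \<oplus>\<^bsub>M\<^esub> v)) \<ominus>\<^bsub>TF\<^esub>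
        (free_gen R TX ((perm_tuple \<pi> x)(\<pi> t := u)) \<oplus>\<^bsub>TF\<^esub>
         free_gen R TX ((perm_tuple \<pi> x)(\<pi> t := v)))"
      unfolding add(5) by (simp add: simps)
    then show ?thesis
      using pt[OF add(1)] in_d[OF add(2)] add(3,4) unfolding multilinear_rels_def Let_def
      by blast
  next
    case smult
    have "perm_free \<pi> f = free_gen R TX ((perm_tuple \<pi> x)(\<pi> t := a \<odot>\<^bsub>M\<^esub> u)) \<ominus>\<^bsub>TF\<^esub>
        a \<odot>\<^bsub>TF\<^esub> free_gen R TX ((perm_tuple \<pi> x)(\<pi> t := u))"
      unfolding smult(5) using smult(3) by (simp add: simps)
    then show ?thesis
      using pt[OF smult(1)] in_d[OF smult(2)] smult(3,4) unfolding multilinear_rels_def Let_def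
      by blast
  qed
qed

private lemma subN: "submodule (tensor_null R M d) R TF"
  by (rule submodule_tensor_null[OF mod])

private lemma N_sub: "tensor_null R M d \<subseteq> carrier TF"
  using TF.submoduleE(1)[OF subN] .

private lemma perm_free_null_subset:
  assumes "\<pi> permutes {1..d}"
  shows "perm_free \<pi> ` tensor_null R M d \<subseteq> tensor_null R M d"
proof -
  let ?N = "tensor_null R M d"
  let ?H = "{f \<in> carrier TF. perm_free \<pi> f \<in> ?N}"
  have zero: "\<zero>\<^bsub>TF\<^esub> \<in> ?N"
    using subgroup.one_closed[OF submodule.axioms(1)[OF subN]] by simp
  have pzero: "perm_free \<pi> \<zero>\<^bsub>TF\<^esub> = \<zero>\<^bsub>TF\<^esub>"
    using perm_tuple_in_tuples_iff[OF assms, of _ "carrier M"]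
    by (auto simp: perm_free_def free_module_def fun_eq_iff restrict_def)
  have "submodule ?H R TF"
    using zero assms
    by (intro TF.submoduleI)
      (auto simp: pzero perm_free_add perm_free_smult perm_free_uminus
        intro: TF.submoduleE[OF subN])
  moreover have "multilinear_rels R M d \<subseteq> ?H"
  proof -
    have "multilinear_rels R M d \<subseteq> ?N"
      by (auto simp: tensor_null_def submodule_span_def)
    then show ?thesis
      using perm_free_rels[OF assms] multilinear_rels_subset[OF mod, of d] by blast
  qed
  ultimately have "?N \<subseteq> ?H"
    by (auto simp: tensor_null_def submodule_span_def)
  then show ?thesis by blast
qed

private lemma perm_free_null: "perm_free \<sigma> ` tensor_null R M d = tensor_null R M d"
proof
  show "tensor_null R M d \<subseteq> perm_free \<sigma> ` tensor_null R M d"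
  proof
    fix f assume "f \<in> tensor_null R M d"
    then have "perm_free (inv' \<sigma>) f \<in> tensor_null R M d"
      using perm_free_null_subset[OF permutes_inv[OF perm]] by blast
    moreover have "f = perm_free \<sigma> (perm_free (inv' \<sigma>) f)"
      using permutes_inv_o[OF perm] by (simp add: perm_free_def comp_assoc)
    ultimately show "f \<in> perm_free \<sigma> ` tensor_null R M d" by blast
  qed
qed (rule perm_free_null_subset[OF perm])

private lemma perm_tensor_coset:
  "perm_tensor \<sigma> (tensor_null R M d +>\<^bsub>TF\<^esub> f) = tensor_null R M d +>\<^bsub>TF\<^esub> perm_free \<sigma> f"
proof -
  have "perm_tensor \<sigma> (tensor_null R M d +>\<^bsub>TF\<^esub> f) =
      (\<lambda>n. n \<oplus>\<^bsub>TF\<^esub> perm_free \<sigma> f) ` (perm_free \<sigma> ` tensor_null R M d)"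
    unfolding perm_tensor_def a_r_coset_def' by (auto simp: perm_free_add[OF perm] image_iff)
  then show ?thesis
    unfolding perm_free_null a_r_coset_def' by auto
qed

private lemma coset_cases:
  assumes "z \<in> carrier (tensor_power R M d)"
  obtains f where "f \<in> carrier TF" "z = tensor_null R M d +>\<^bsub>TF\<^esub> f"
  using assms by (auto simp: tensor_power_def quot_module_def A_RCOSETS_def')

private lemma coset_add:
  assumes "f \<in> carrier TF" "g \<in> carrier TF"
  shows "(tensor_null R M d +>\<^bsub>TF\<^esub> f) \<oplus>\<^bsub>tensor_power R M d\<^esub> (tensor_null R M d +>\<^bsub>TF\<^esub> g)
    = tensor_null R M d +>\<^bsub>TF\<^esub> (f \<oplus>\<^bsub>TF\<^esub> g)"
proof -
  have sub: "additive_subgroup (tensor_null R M d) TF"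
    by (rule additive_subgroup.intro) (rule submodule.axioms(1)[OF subN])
  interpret N: abelian_subgroup "tensor_null R M d" TF
    by (rule abelian_subgroupI3[OF sub]) (rule module.axioms(2)[OF modF])
  show ?thesis
    using assms by (simp add: tensor_power_def quot_module_def N.a_rcos_sum)
qed

lemma perm_tensor_closed:
  assumes "z \<in> carrier (tensor_power R M d)"
  shows "perm_tensor \<sigma> z \<in> carrier (tensor_power R M d)"
proof -
  from assms obtain f where "f \<in> carrier TF" "z = tensor_null R M d +>\<^bsub>TF\<^esub> f"
    by (rule coset_cases)
  then show ?thesis
    using perm_free_closed[OF perm]
    by (auto simp: perm_tensor_coset) (auto simp: tensor_power_def quot_module_def A_RCOSETS_def')
qed

lemma perm_tensor_tensor: "perm_tensor \<sigma> (tensor R M d x) = tensor R M d (perm_tuple \<sigma> x)"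
  by (simp add: tensor_def perm_tensor_coset perm_free_gen[OF perm])

lemma perm_tensor_add:
  assumes "z \<in> carrier (tensor_power R M d)" "w \<in> carrier (tensor_power R M d)"
  shows "perm_tensor \<sigma> (z \<oplus>\<^bsub>tensor_power R M d\<^esub> w) =
    perm_tensor \<sigma> z \<oplus>\<^bsub>tensor_power R M d\<^esub> perm_tensor \<sigma> w"
proof -
  from assms(1) obtain f where f: "f \<in> carrier TF" "z = tensor_null R M d +>\<^bsub>TF\<^esub> f"
    by (rule coset_cases)
  from assms(2) obtain g where g: "g \<in> carrier TF" "w = tensor_null R M d +>\<^bsub>TF\<^esub> g"
    by (rule coset_cases)
  show ?thesis
    using f(1) g(1) perm_free_closed[OF perm]
    by (simp add: f(2) g(2) coset_add perm_tensor_coset perm_free_add[OF perm])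
qed

lemma perm_tensor_smult:
  assumes "a \<in> carrier R" "z \<in> carrier (tensor_power R M d)"
  shows "perm_tensor \<sigma> (a \<odot>\<^bsub>tensor_power R M d\<^esub> z) = a \<odot>\<^bsub>tensor_power R M d\<^esub> perm_tensor \<sigma> z"
proof -
  from assms(2) obtain f where f: "f \<in> carrier TF" "z = tensor_null R M d +>\<^bsub>TF\<^esub> f"
    by (rule coset_cases)
  show ?thesis
    using assms(1) f(1) perm_free_closed[OF perm]
    unfolding tensor_power_def
    by (simp add: f(2) quot_module_smult[OF modF subN] perm_tensor_coset perm_free_smult[OF perm])
qed

end

lemma module_semi_sym_power:
  assumes "module R M" "W \<subseteq> carrier (sym_group d)" "\<chi> \<in> W \<rightarrow> Units R"
  shows "module R (semi_sym_power R M d W \<chi>)"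
proof -
  interpret M: module R M by fact
  interpret T: module R "tensor_power R M d" by (rule module_tensor_power[OF assms(1)])
  have "{(inv\<^bsub>R\<^esub> (\<chi> \<sigma>)) \<odot>\<^bsub>tensor_power R M d\<^esub> z \<ominus>\<^bsub>tensor_power R M d\<^esub> perm_tensor \<sigma> z | \<sigma> z.
      \<sigma> \<in> W \<and> z \<in> carrier (tensor_power R M d)} \<subseteq> carrier (tensor_power R M d)"
  proof clarify
    fix \<sigma> z assume "\<sigma> \<in> W" "z \<in> carrier (tensor_power R M d)"
    moreover from this have "\<sigma> permutes {1..d}" "\<chi> \<sigma> \<in> Units R"
      using assms by (auto simp: sym_group_carrier)
    ultimately show "(inv\<^bsub>R\<^esub> (\<chi> \<sigma>)) \<odot>\<^bsub>tensor_power R M d\<^esub> z \<ominus>\<^bsub>tensor_power R M d\<^esub> perm_tensor \<sigma> z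
        \<in> carrier (tensor_power R M d)"
      using perm_tensor_closed[OF assms(1)] by simp
  qed
  then show ?thesis
    unfolding semi_sym_power_def semi_sym_null_def Let_def
    by (intro module_quot_module submodule_submodule_span T.module_axioms)
qed

end

theory Submission
  imports Defs "HOL-Algebra.Divisibility"
begin

text \<open>Write \<open>x \<mapsto> \<phi>(x)\<close> for the map from tuples to the semi-symmetric power. Its multilinearity
  reduces spanning to the elements \<open>\<phi>(e\<^sub>i)\<close>, and \<open>\<phi>(e\<^bsub>\<sigma>i\<^esub>) = \<chi>(\<sigma>)\<inverse> \<phi>(e\<^sub>i)\<close> reduces further to one
  index per orbit. If \<open>\<chi>\<close> is nontrivial on \<open>W\<^sub>i\<close> then \<open>|W\<^sub>i| \<phi>(e\<^sub>i) = (\<Sum>\<^bsub>\<tau> \<in> Stab i\<^esub> \<chi>(\<tau>)) \<phi>(e\<^sub>i) = 0\<close>, the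
  character sum being zero in a domain, and \<open>|W\<^sub>i|\<close> is a unit since it divides \<open>|W|\<close>.
  For independence, let \<open>P\<^sub>j(x)\<close> be the product of the \<open>j\<^sub>t\<close>-th coordinates of the \<open>x\<^sub>t\<close>. The form
  \<open>x \<mapsto> \<Sum>\<^bsub>\<sigma> \<in> W\<^esub> \<chi>(\<sigma>) P\<^sub>j(\<sigma> x)\<close> is multilinear and transforms by \<open>\<chi>\<inverse>\<close>, so it descends to the
  semi-symmetric power, where it takes the value \<open>|W\<^sub>j|\<close> at \<open>\<phi>(e\<^sub>j)\<close> and \<open>0\<close> at the other
  \<open>\<phi>(e\<^sub>i)\<close> with \<open>i \<in> J\<close>.\<close>

section \<open>Linear maps between modules and linear forms\<close>

text \<open>Linear and multilinear forms become maps into this module, so \<open>module_hom\<close>,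
  \<open>multilinear_map\<close> and the lifting lemmas apply to them without separate
  versions.\<close>

definition regular_module :: "('k, 'r) ring_scheme \<Rightarrow> ('k, 'k) module"
  where "regular_module R =
    \<lparr>carrier = carrier R, monoid.mult = monoid.mult R, one = \<one>\<^bsub>R\<^esub>, zero = \<zero>\<^bsub>R\<^esub>,
     add = add R, smult = monoid.mult R\<rparr>"

lemma regular_module_simps [simp]:
  "carrier (regular_module R) = carrier R"
  "\<zero>\<^bsub>regular_module R\<^esub> = \<zero>\<^bsub>R\<^esub>"
  "x \<oplus>\<^bsub>regular_module R\<^esub> y = x \<oplus>\<^bsub>R\<^esub> y"
  "a \<odot>\<^bsub>regular_module R\<^esub> x = a \<otimes>\<^bsub>R\<^esub> x"
  "finsum (regular_module R) f A = finsum R f A"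
  by (simp_all add: regular_module_def finsum_def finprod_def)

lemma module_regular_module:
  assumes "cring R"
  shows "module R (regular_module R)"
proof -
  interpret cring R by fact
  show ?thesis
  proof (rule moduleI)
    show "abelian_group (regular_module R)"
      by (rule abelian_groupI) (auto simp: a_ac intro: l_neg)
  qed (auto simp: assms l_distr r_distr m_assoc)
qed

locale module_hom = M: module R M + N: module R N
  for R :: "('k, 'r) ring_scheme" and M :: "('k, 'a, 'm) module_scheme"
    and N :: "('k, 'b, 'n) module_scheme" and h :: "'a \<Rightarrow> 'b" +
  assumes hom_closed [simp]: "x \<in> carrier M \<Longrightarrow> h x \<in> carrier N"
    and hom_add: "\<lbrakk>x \<in> carrier M; y \<in> carrier M\<rbrakk> \<Longrightarrow> h (x \<oplus>\<^bsub>M\<^esub> y) = h x \<oplus>\<^bsub>N\<^esub> h y"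
    and hom_smult: "\<lbrakk>a \<in> carrier R; x \<in> carrier M\<rbrakk> \<Longrightarrow> h (a \<odot>\<^bsub>M\<^esub> x) = a \<odot>\<^bsub>N\<^esub> h x"
begin

lemma hom_zero [simp]: "h \<zero>\<^bsub>M\<^esub> = \<zero>\<^bsub>N\<^esub>"
  using hom_smult[of "\<zero>\<^bsub>R\<^esub>" "\<zero>\<^bsub>M\<^esub>"] by simp

lemma hom_uminus:
  assumes "x \<in> carrier M"
  shows "h (\<ominus>\<^bsub>M\<^esub> x) = \<ominus>\<^bsub>N\<^esub> h x"
  using assms hom_smult[of "\<ominus>\<^bsub>R\<^esub> \<one>\<^bsub>R\<^esub>" x] by (simp add: M.smult_l_minus N.smult_l_minus)

lemma hom_minus:
  "\<lbrakk>x \<in> carrier M; y \<in> carrier M\<rbrakk> \<Longrightarrow> h (x \<ominus>\<^bsub>M\<^esub> y) = h x \<ominus>\<^bsub>N\<^esub> h y"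
  by (simp add: a_minus_def hom_add hom_uminus)

lemma hom_finsum:
  "f \<in> A \<rightarrow> carrier M \<Longrightarrow> h (\<Oplus>\<^bsub>M\<^esub>i\<in>A. f i) = (\<Oplus>\<^bsub>N\<^esub>i\<in>A. h (f i))"
  by (induction A rule: infinite_finite_induct) (auto simp: Pi_def hom_add)

text \<open>Reduces statements about spans to their generators: a linear map sends a span into
  \<open>S\<close> as soon as it sends the generators there. Taking \<open>S\<close> to be the zero
  submodule gives the kernel.\<close>

lemma submodule_vimage:
  assumes "submodule S R N"
  shows "submodule {x \<in> carrier M. h x \<in> S} R M"
  using subgroup.one_closed[OF submodule.axioms(1)[OF assms]]
  by (intro M.submoduleI)
    (auto simp: hom_add hom_uminus hom_smult N.submoduleE(3-5)[OF assms])

lemma submodule_image: "submodule (h ` carrier M) R N"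
proof (rule N.submoduleI)
  show "\<zero>\<^bsub>N\<^esub> \<in> h ` carrier M"
    by (rule image_eqI[of _ _ "\<zero>\<^bsub>M\<^esub>"]) simp_all
next
  fix y assume "y \<in> h ` carrier M"
  then obtain x where "x \<in> carrier M" "y = h x" by blast
  then show "\<ominus>\<^bsub>N\<^esub> y \<in> h ` carrier M"
    by (intro image_eqI[of _ _ "\<ominus>\<^bsub>M\<^esub> x"]) (simp_all add: hom_uminus)
next
  fix y z assume "y \<in> h ` carrier M" "z \<in> h ` carrier M"
  then obtain v x where "v \<in> carrier M" "y = h v" "x \<in> carrier M" "z = h x" by blast
  then show "y \<oplus>\<^bsub>N\<^esub> z \<in> h ` carrier M"
    by (intro image_eqI[of _ _ "v \<oplus>\<^bsub>M\<^esub> x"]) (simp_all add: hom_add)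
next
  fix a y assume "a \<in> carrier R" "y \<in> h ` carrier M"
  moreover from this obtain x where "x \<in> carrier M" "y = h x" by blast
  ultimately show "a \<odot>\<^bsub>N\<^esub> y \<in> h ` carrier M"
    by (intro image_eqI[of _ _ "a \<odot>\<^bsub>M\<^esub> x"]) (simp_all add: hom_smult)
qed auto

end

lemma (in abelian_group) minus_eq_zero_iff:
  "\<lbrakk>x \<in> carrier G; y \<in> carrier G\<rbrakk> \<Longrightarrow> x \<ominus> y = \<zero> \<longleftrightarrow> x = y"
  using add.inv_solve_right[of \<zero> x y] by (auto simp: a_minus_def r_neg)

lemma (in module) submodule_zero: "submodule {\<zero>\<^bsub>M\<^esub>} R M"
  by (intro submoduleI) auto

text \<open>Two linear maps that agree on a generating set therefore agree everywhere. This later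
  carries equivariance from pure tensors to the whole tensor power.\<close>

lemma submodule_equalizer:
  assumes "module_hom R M N h" "module_hom R M N g"
  shows "submodule {x \<in> carrier M. h x = g x} R M"
proof -
  interpret h: module_hom R M N h by fact
  interpret g: module_hom R M N g by fact
  show ?thesis
    by (intro h.M.submoduleI)
      (auto simp: h.hom_add g.hom_add h.hom_uminus g.hom_uminus h.hom_smult g.hom_smult)
qed

lemma module_hom_comp:
  assumes "module_hom R M N h" "module_hom R N P g"
  shows "module_hom R M P (\<lambda>x. g (h x))"
proof -
  interpret h: module_hom R M N h by fact
  interpret g: module_hom R N P g by fact
  show ?thesis
    by unfold_locales (auto simp: h.hom_add g.hom_add h.hom_smult g.hom_smult)
qed

lemma submodule_span_least: "\<lbrakk>submodule N R M; S \<subseteq> N\<rbrakk> \<Longrightarrow> submodule_span R M S \<subseteq> N"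
  by (auto simp: submodule_span_def)

lemma submodule_span_superset: "S \<subseteq> submodule_span R M S"
  by (auto simp: submodule_span_def)


section \<open>Free modules\<close>

lemma free_gen_closed: "cring R \<Longrightarrow> free_gen R X x \<in> carrier (free_module R X)"
  by (auto simp: free_gen_def free_module_def cring.cring_simprules)

text \<open>Induction on a finite set containing the support of \<open>f\<close>, splitting off the
  contribution of one point at a time.\<close>

lemma free_module_generated:
  assumes "cring R" "submodule S R (free_module R X)" "free_gen R X ` X \<subseteq> S"
    and "f \<in> carrier (free_module R X)"
  shows "f \<in> S"
proof -
  interpret R: cring R by fact
  interpret F: module R "free_module R X" by (rule module_free_module) fact
  have *: "f \<in> S" if "finite A" "A \<subseteq> X" "f \<in> carrier (free_module R X)" "\<forall>x\<in>X - A. f x = \<zero>\<^bsub>R\<^esub>" for A f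
    using that
  proof (induction A arbitrary: f)
    case empty
    then have "f = \<zero>\<^bsub>free_module R X\<^esub>"
      by (auto simp: free_module_def fun_eq_iff PiE_iff extensional_def)
    then show ?case
      using subgroup.one_closed[OF submodule.axioms(1)[OF assms(2)]] by simp
  next
    case (insert a A)
    \<comment> \<open>Clearing the value at \<open>a\<close> leaves a function supported in
      \<open>A\<close>; adding \<open>f a\<close> times the generator at \<open>a\<close> restores
      \<open>f\<close>.\<close>
    let ?g = "f(a := \<zero>\<^bsub>R\<^esub>)"
    have g: "?g \<in> carrier (free_module R X)"
    proof -
      have "finite {x \<in> X. ?g x \<noteq> \<zero>\<^bsub>R\<^esub>}"
        using insert.prems(2) by (auto simp: free_module_def elim!: finite_subset[rotated])
      then show ?thesis
        using insert.prems(1,2) by (auto simp: free_module_def PiE_iff extensional_def)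
    qed
    have "?g \<in> S" using insert.prems by (intro insert.IH g) auto
    moreover have "f a \<odot>\<^bsub>free_module R X\<^esub> free_gen R X a \<in> S"
      using insert.prems assms(3)
      by (intro F.submoduleE(4)[OF assms(2)]) (auto simp: free_module_def)
    moreover have "f = ?g \<oplus>\<^bsub>free_module R X\<^esub> f a \<odot>\<^bsub>free_module R X\<^esub> free_gen R X a"
      using insert.prems
      by (auto simp: free_module_def free_gen_def fun_eq_iff PiE_iff extensional_def)
    ultimately show ?case
      using F.submoduleE(5)[OF assms(2)] by metis
  qed
  show ?thesis
    using assms(4) by (intro *[of "{x \<in> X. f x \<noteq> \<zero>\<^bsub>R\<^esub>}"]) (auto simp: free_module_def)
qed

text \<open>Summing over the support keeps the sum finite for every element of the free module,
  whereas \<open>finsum\<close> over an infinite \<open>X\<close> would return its default value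
  zero.\<close>

definition linear_extension ::
  "('k, 'r) ring_scheme \<Rightarrow> ('k, 'e, 'm) module_scheme \<Rightarrow> 'x set \<Rightarrow> ('x \<Rightarrow> 'e) \<Rightarrow> ('x \<Rightarrow> 'k) \<Rightarrow> 'e"
  where "linear_extension R M X b f =
    (\<Oplus>\<^bsub>M\<^esub> x \<in> {x \<in> X. f x \<noteq> \<zero>\<^bsub>R\<^esub>}. f x \<odot>\<^bsub>M\<^esub> b x)"

text \<open>The range of summation in \<open>linear_extension\<close> depends on \<open>f\<close>.
  Enlarging it only adds zero terms, so the values at several functions can be compared over one
  common finite set.\<close>

lemma linear_extension_eq:
  assumes "module R M" "b \<in> X \<rightarrow> carrier M" "f \<in> X \<rightarrow> carrier R"
    and "finite A" "A \<subseteq> X" "{x \<in> X. f x \<noteq> \<zero>\<^bsub>R\<^esub>} \<subseteq> A"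
  shows "linear_extension R M X b f = (\<Oplus>\<^bsub>M\<^esub> x \<in> A. f x \<odot>\<^bsub>M\<^esub> b x)"
proof -
  interpret module R M by fact
  show ?thesis
    unfolding linear_extension_def using assms(2-)
    by (intro M.add.finprod_mono_neutral_cong_left) (auto simp: Pi_def subset_iff)
qed

lemma module_hom_linear_extension:
  assumes "module R M" "b \<in> X \<rightarrow> carrier M"
  shows "module_hom R (free_module R X) M (linear_extension R M X b)"
proof -
  interpret M: module R M by fact
  interpret F: module R "free_module R X" by (rule module_free_module) (rule M.is_cring)
  note eq = linear_extension_eq[OF assms]
  have supp: "finite {x \<in> X. f x \<noteq> \<zero>\<^bsub>R\<^esub>}" "f \<in> X \<rightarrow> carrier R"
    if "f \<in> carrier (free_module R X)" for f
    using that by (auto simp: free_module_def)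
  show ?thesis
  proof
    fix f assume "f \<in> carrier (free_module R X)"
    then show "linear_extension R M X b f \<in> carrier M"
      using assms(2) supp(2) unfolding linear_extension_def
      by (intro M.finsum_closed) (auto simp: Pi_def)
  next
    fix f g assume f: "f \<in> carrier (free_module R X)" and g: "g \<in> carrier (free_module R X)"
    let ?A = "{x \<in> X. f x \<noteq> \<zero>\<^bsub>R\<^esub>} \<union> {x \<in> X. g x \<noteq> \<zero>\<^bsub>R\<^esub>}"
    let ?h = "f \<oplus>\<^bsub>free_module R X\<^esub> g"
    have h: "?h x = f x \<oplus>\<^bsub>R\<^esub> g x" if "x \<in> X" for x
      using that by (simp add: free_module_def)
    have fin: "finite ?A" using supp f g by simp
    have "linear_extension R M X b ?h = (\<Oplus>\<^bsub>M\<^esub> x \<in> ?A. ?h x \<odot>\<^bsub>M\<^esub> b x)"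
      using supp(2)[OF F.a_closed[OF f g]] by (intro eq fin) (auto simp: h)
    also have "\<dots> = (\<Oplus>\<^bsub>M\<^esub> x \<in> ?A. f x \<odot>\<^bsub>M\<^esub> b x \<oplus>\<^bsub>M\<^esub> g x \<odot>\<^bsub>M\<^esub> b x)"
      using assms(2) supp(2)[OF f] supp(2)[OF g]
      by (intro M.finsum_cong') (auto simp: h Pi_def M.smult_l_distr)
    also have "\<dots> = (\<Oplus>\<^bsub>M\<^esub> x \<in> ?A. f x \<odot>\<^bsub>M\<^esub> b x) \<oplus>\<^bsub>M\<^esub> (\<Oplus>\<^bsub>M\<^esub> x \<in> ?A. g x \<odot>\<^bsub>M\<^esub> b x)"
      using assms(2) supp(2)[OF f] supp(2)[OF g] by (intro M.finsum_addf) (auto simp: Pi_def)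
    also have "\<dots> = linear_extension R M X b f \<oplus>\<^bsub>M\<^esub> linear_extension R M X b g"
      using supp(2)[OF f] supp(2)[OF g] fin by (intro arg_cong2[of _ _ _ _ "add M"] eq[symmetric]) auto
    finally show "linear_extension R M X b ?h =
        linear_extension R M X b f \<oplus>\<^bsub>M\<^esub> linear_extension R M X b g" .
  next
    fix a f assume a: "a \<in> carrier R" and f: "f \<in> carrier (free_module R X)"
    let ?A = "{x \<in> X. f x \<noteq> \<zero>\<^bsub>R\<^esub>}" and ?h = "a \<odot>\<^bsub>free_module R X\<^esub> f"
    have h: "?h x = a \<otimes>\<^bsub>R\<^esub> f x" if "x \<in> X" for x
      using that by (simp add: free_module_def)
    have "linear_extension R M X b ?h = (\<Oplus>\<^bsub>M\<^esub> x \<in> ?A. ?h x \<odot>\<^bsub>M\<^esub> b x)"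
      using supp(2)[OF F.smult_closed[OF a f]] supp(1)[OF f] a by (intro eq) (auto simp: h)
    also have "\<dots> = (\<Oplus>\<^bsub>M\<^esub> x \<in> ?A. a \<odot>\<^bsub>M\<^esub> (f x \<odot>\<^bsub>M\<^esub> b x))"
      using assms(2) supp(2)[OF f] a
      by (intro M.finsum_cong') (auto simp: h Pi_def M.smult_assoc1)
    also have "\<dots> = a \<odot>\<^bsub>M\<^esub> linear_extension R M X b f"
      unfolding linear_extension_def using assms(2) supp[OF f] a
      by (intro M.finsum_smult_ldistr[symmetric]) (auto simp: Pi_def)
    finally show "linear_extension R M X b ?h = a \<odot>\<^bsub>M\<^esub> linear_extension R M X b f" .
  qed
qed

lemma linear_extension_free_gen:
  assumes "module R M" "b \<in> X \<rightarrow> carrier M" "x \<in> X"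
  shows "linear_extension R M X b (free_gen R X x) = b x"
proof -
  interpret module R M by fact
  have "linear_extension R M X b (free_gen R X x) = (\<Oplus>\<^bsub>M\<^esub> y \<in> {x}. free_gen R X x y \<odot>\<^bsub>M\<^esub> b y)"
    using assms by (intro linear_extension_eq) (auto simp: free_gen_def split: if_splits)
  then show ?thesis
    using assms(2,3) by (auto simp: free_gen_def Pi_def)
qed

lemma module_hom_eval:
  assumes "cring R" "x \<in> X"
  shows "module_hom R (free_module R X) (regular_module R) (\<lambda>f. f x)"
  using assms
  by (intro module_hom.intro module_hom_axioms.intro module_free_module module_regular_module)
    (auto simp: free_module_def)

text \<open>For a basis, the linear extension of \<open>b\<close> is an isomorphism from the free
  module on \<open>I\<close>. The coordinate forms are its inverse followed by evaluation at a
  point.\<close>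

lemma basis_family_coordinates:
  assumes "module R M" "basis_family R M I b"
  obtains coord where "\<And>i. i \<in> I \<Longrightarrow> module_hom R M (regular_module R) (coord i)"
    "\<And>i k. \<lbrakk>i \<in> I; k \<in> I\<rbrakk> \<Longrightarrow> coord i (b k) = (if k = i then \<one>\<^bsub>R\<^esub> else \<zero>\<^bsub>R\<^esub>)"
proof -
  interpret M: module R M by fact
  let ?F = "free_module R I" and ?h = "linear_extension R M I b"
  have b: "b \<in> I \<rightarrow> carrier M" and indep: "lin_indep_family R M I b"
    and gen: "submodule_span R M (b ` I) = carrier M"
    using assms(2) by (auto simp: basis_family_def)
  interpret h: module_hom R ?F M ?h by (rule module_hom_linear_extension[OF assms(1) b])
  have "b ` I \<subseteq> ?h ` carrier ?F"
    using linear_extension_free_gen[OF assms(1) b] free_gen_closed[OF M.is_cring]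
    by (metis (no_types, lifting) image_eqI image_subsetI)
  then have surj: "?h ` carrier ?F = carrier M"
    using submodule_span_least[OF h.submodule_image] M.submoduleE(1)[OF h.submodule_image] gen
    by (metis subset_antisym)
  \<comment> \<open>Linear independence speaks of finite index sets; here it is applied to the
    support of \<open>f\<close>, which is finite and on which no coefficient may survive.\<close>
  have ker: "f = \<zero>\<^bsub>?F\<^esub>" if f: "f \<in> carrier ?F" "?h f = \<zero>\<^bsub>M\<^esub>" for f
  proof -
    let ?A = "{i \<in> I. f i \<noteq> \<zero>\<^bsub>R\<^esub>}"
    have "finite ?A" "f \<in> ?A \<rightarrow> carrier R"
      using f(1) by (auto simp: free_module_def)
    moreover have "(\<Oplus>\<^bsub>M\<^esub> i \<in> ?A. f i \<odot>\<^bsub>M\<^esub> b i) = \<zero>\<^bsub>M\<^esub>"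
      using f(2) by (simp add: linear_extension_def)
    ultimately have "\<forall>i\<in>?A. f i = \<zero>\<^bsub>R\<^esub>"
      using indep unfolding lin_indep_family_def by blast
    then show ?thesis
      using f(1) by (auto simp: free_module_def fun_eq_iff PiE_iff extensional_def)
  qed
  have inj: "inj_on ?h (carrier ?F)"
  proof (rule inj_onI)
    fix f g assume fg: "f \<in> carrier ?F" "g \<in> carrier ?F" "?h f = ?h g"
    then have "f \<ominus>\<^bsub>?F\<^esub> g = \<zero>\<^bsub>?F\<^esub>"
      by (intro ker) (auto simp: h.hom_minus M.minus_eq_zero_iff)
    then show "f = g" using fg(1,2) by (simp add: h.M.minus_eq_zero_iff)
  qed
  \<comment> \<open>The inverse isomorphism, sending an element to its function of coefficients. It
    is linear because \<open>?h\<close> is linear and injective.\<close>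
  let ?k = "inv_into (carrier ?F) ?h"
  have k: "?k x \<in> carrier ?F" "?h (?k x) = x" if "x \<in> carrier M" for x
    using that surj by (auto simp: inv_into_into f_inv_into_f)
  interpret k: module_hom R M ?F ?k
    by unfold_locales
      (auto simp: k h.hom_add h.hom_smult intro!: inv_into_f_eq[OF inj])
  show thesis
  proof
    fix i assume i: "i \<in> I"
    show "module_hom R M (regular_module R) (\<lambda>x. ?k x i)"
      by (rule module_hom_comp[OF k.module_hom_axioms module_hom_eval[OF M.is_cring i]])
    fix l assume l: "l \<in> I"
    have "?k (b l) = free_gen R I l"
      using inv_into_f_f[OF inj free_gen_closed[OF M.is_cring, of I l]] l
      by (simp add: linear_extension_free_gen[OF assms(1) b])
    then show "?k (b l) i = (if l = i then \<one>\<^bsub>R\<^esub> else \<zero>\<^bsub>R\<^esub>)"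
      using i by (auto simp: free_gen_def)
  qed
qed


section \<open>Quotient modules\<close>

lemma submodule_imp_abelian_subgroup:
  assumes "module R M" "submodule N R M"
  shows "abelian_subgroup N M"
  using module.axioms(2)[OF assms(1)] submodule.axioms(1)[OF assms(2)]
  by (intro abelian_subgroupI3 additive_subgroup.intro)

lemma carrier_quot_module: "carrier (quot_module M N) = (\<lambda>x. N +>\<^bsub>M\<^esub> x) ` carrier M"
  by (auto simp: quot_module_def A_RCOSETS_def')

lemma zero_quot_module: "\<zero>\<^bsub>quot_module M N\<^esub> = N"
  by (simp add: quot_module_def)

lemma module_hom_quot_module:
  assumes "module R M" "submodule N R M"
  shows "module_hom R M (quot_module M N) (\<lambda>x. N +>\<^bsub>M\<^esub> x)"
proof -
  interpret abelian_subgroup N M using assms by (rule submodule_imp_abelian_subgroup)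
  show ?thesis
    using assms a_rcos_sum
    by (intro module_hom.intro module_hom_axioms.intro module_quot_module)
      (simp_all add: carrier_quot_module quot_module_smult, simp add: quot_module_def)
qed

lemma quot_module_eq_zero_iff:
  assumes "module R M" "submodule N R M" "x \<in> carrier M"
  shows "N +>\<^bsub>M\<^esub> x = \<zero>\<^bsub>quot_module M N\<^esub> \<longleftrightarrow> x \<in> N"
proof -
  interpret abelian_subgroup N M using assms(1,2) by (rule submodule_imp_abelian_subgroup)
  show ?thesis
    unfolding zero_quot_module using a_rcos_self[OF assms(3)] a_rcos_const[of x] by metis
qed

text \<open>The induced map evaluates \<open>h\<close> at an arbitrarily chosen representative of a
  coset. Representatives of one coset differ by elements of \<open>N\<close>, which \<open>h\<close>
  kills, so the choice does not matter.\<close>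

lemma quot_module_lift:
  assumes "module_hom R M M' h" "submodule N R M" "\<And>x. x \<in> N \<Longrightarrow> h x = \<zero>\<^bsub>M'\<^esub>"
  obtains g where "module_hom R (quot_module M N) M' g"
    "\<And>x. x \<in> carrier M \<Longrightarrow> g (N +>\<^bsub>M\<^esub> x) = h x"
proof -
  interpret h: module_hom R M M' h by fact
  interpret N: abelian_subgroup N M
    using h.M.module_axioms assms(2) by (rule submodule_imp_abelian_subgroup)
  interpret q: module_hom R M "quot_module M N" "\<lambda>x. N +>\<^bsub>M\<^esub> x"
    by (rule module_hom_quot_module[OF h.M.module_axioms assms(2)])
  let ?g = "\<lambda>C. h (SOME x. x \<in> C)"
  have g: "?g (N +>\<^bsub>M\<^esub> x) = h x" if "x \<in> carrier M" for x
  proof -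
    have "(SOME y. y \<in> N +>\<^bsub>M\<^esub> x) \<in> N +>\<^bsub>M\<^esub> x"
      using N.a_rcos_self[OF that] by (rule someI)
    then obtain n where "n \<in> N" "(SOME y. y \<in> N +>\<^bsub>M\<^esub> x) = n \<oplus>\<^bsub>M\<^esub> x"
      by (auto simp: a_r_coset_def')
    moreover from this have "n \<in> carrier M" using N.a_subset by blast
    ultimately show ?thesis
      using that assms(3) by (simp add: h.hom_add)
  qed
  show thesis
  proof
    show "module_hom R (quot_module M N) M' ?g"
    proof
      fix C assume "C \<in> carrier (quot_module M N)"
      then show "?g C \<in> carrier M'" by (auto simp: carrier_quot_module g)
    next
      fix C D assume "C \<in> carrier (quot_module M N)" "D \<in> carrier (quot_module M N)"
      then show "?g (C \<oplus>\<^bsub>quot_module M N\<^esub> D) = ?g C \<oplus>\<^bsub>M'\<^esub> ?g D"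
        by (auto simp: carrier_quot_module g h.hom_add simp flip: q.hom_add)
    next
      fix a C assume "a \<in> carrier R" "C \<in> carrier (quot_module M N)"
      then show "?g (a \<odot>\<^bsub>quot_module M N\<^esub> C) = a \<odot>\<^bsub>M'\<^esub> ?g C"
        by (auto simp: carrier_quot_module g h.hom_smult simp flip: q.hom_smult)
    qed
  qed (rule g)
qed


section \<open>Multilinear maps\<close>

text \<open>Keeps the index range \<open>{1..d}\<close> from being rewritten to \<open>{Suc 0..d}\<close>.\<close>

declare One_nat_def [simp del]

text \<open>Both conditions are phrased with one-place updates, as in
  \<open>multilinear_rels\<close>, so that they can be matched directly with the relations defining
  the tensor power.\<close>

definition multilinear_map ::
  "('k, 'r) ring_scheme \<Rightarrow> ('k, 'e, 'm) module_scheme \<Rightarrow> nat \<Rightarrow> ('k, 'f, 'n) module_scheme \<Rightarrow>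
    ((nat \<Rightarrow> 'e) \<Rightarrow> 'f) \<Rightarrow> bool"
  where "multilinear_map R M d N \<phi> \<longleftrightarrow>
    \<phi> \<in> tuples d (carrier M) \<rightarrow> carrier N \<and>
    (\<forall>x\<in>tuples d (carrier M). \<forall>t\<in>{1..d}. \<forall>u\<in>carrier M.
      (\<forall>v\<in>carrier M. \<phi> (x(t := u \<oplus>\<^bsub>M\<^esub> v)) = \<phi> (x(t := u)) \<oplus>\<^bsub>N\<^esub> \<phi> (x(t := v))) \<and>
      (\<forall>a\<in>carrier R. \<phi> (x(t := a \<odot>\<^bsub>M\<^esub> u)) = a \<odot>\<^bsub>N\<^esub> \<phi> (x(t := u))))"

lemma multilinear_mapD:
  assumes "multilinear_map R M d N \<phi>" "x \<in> tuples d (carrier M)"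
  shows "\<phi> x \<in> carrier N"
    and "\<lbrakk>t \<in> {1..d}; u \<in> carrier M; v \<in> carrier M\<rbrakk> \<Longrightarrow>
      \<phi> (x(t := u \<oplus>\<^bsub>M\<^esub> v)) = \<phi> (x(t := u)) \<oplus>\<^bsub>N\<^esub> \<phi> (x(t := v))"
    and "\<lbrakk>t \<in> {1..d}; u \<in> carrier M; a \<in> carrier R\<rbrakk> \<Longrightarrow>
      \<phi> (x(t := a \<odot>\<^bsub>M\<^esub> u)) = a \<odot>\<^bsub>N\<^esub> \<phi> (x(t := u))"
  using assms by (auto simp: multilinear_map_def simp del: atLeastAtMost_iff)

lemma tuples_upd: "\<lbrakk>x \<in> tuples d A; t \<in> {1..d}; u \<in> A\<rbrakk> \<Longrightarrow> x(t := u) \<in> tuples d A"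
  by (auto simp: PiE_iff extensional_def)

text \<open>The entries are released from \<open>B\<close> one place at a time. The induction runs
  over the set \<open>A\<close> of places whose entry may be arbitrary, starting from tuples with
  all entries in \<open>B\<close> and ending with \<open>A\<close> equal to
  \<open>{1..d}\<close>.\<close>

lemma multilinear_map_in_submodule:
  assumes "module R M" "module R N" "multilinear_map R M d N \<phi>" "submodule S R N"
    and "submodule_span R M B = carrier M" "\<And>x. x \<in> tuples d B \<Longrightarrow> \<phi> x \<in> S"
    and "x \<in> tuples d (carrier M)"
  shows "\<phi> x \<in> S"
proof -
  interpret M: module R M by fact
  interpret N: module R N by fact
  note S = N.submoduleE[OF assms(4)]
  note multi = multilinear_mapD[OF assms(3)]
  have "\<phi> x \<in> S"
    if "finite A" "A \<subseteq> {1..d}" "x \<in> tuples d (carrier M)" "\<forall>t\<in>{1..d} - A. x t \<in> B" for A x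
    using that
  proof (induction A arbitrary: x)
    case empty
    then show ?case by (intro assms(6)) (auto simp: PiE_iff)
  next
    case (insert t A)
    have t: "t \<in> {1..d}" and x: "x \<in> tuples d (carrier M)" using insert.prems by auto
    \<comment> \<open>The entries admissible at place \<open>t\<close> form a submodule by linearity
      in that place. It contains \<open>B\<close> by the induction hypothesis, hence contains the
      span of \<open>B\<close>, which is all of \<open>M\<close>.\<close>
    let ?H = "{u \<in> carrier M. \<phi> (x(t := u)) \<in> S}"
    have scale: "a \<odot>\<^bsub>M\<^esub> u \<in> ?H" if "a \<in> carrier R" "u \<in> ?H" for a u
      using that S(4) by (simp add: multi(3)[OF x t])
    have B: "B \<subseteq> carrier M"
      using assms(5) submodule_span_superset[of B R M] by simp
    have BH: "B \<subseteq> ?H"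
    proof
      fix u assume u: "u \<in> B"
      have "\<phi> (x(t := u)) \<in> S"
        using insert.prems u B t by (intro insert.IH tuples_upd) auto
      then show "u \<in> ?H" using u B by auto
    qed
    have "submodule ?H R M"
    proof (rule M.submoduleI)
      have "\<phi> (x(t := \<zero>\<^bsub>M\<^esub>)) = \<zero>\<^bsub>N\<^esub>"
        using multi(3)[OF x t, of "\<zero>\<^bsub>M\<^esub>" "\<zero>\<^bsub>R\<^esub>"] multi(1)[OF tuples_upd[OF x t]] by simp
      then show "\<zero>\<^bsub>M\<^esub> \<in> ?H"
        using subgroup.one_closed[OF submodule.axioms(1)[OF assms(4)]] by simp
      show "\<ominus>\<^bsub>M\<^esub> u \<in> ?H" if "u \<in> ?H" for u
        using scale[of "\<ominus>\<^bsub>R\<^esub> \<one>\<^bsub>R\<^esub>" u] that by (simp add: M.smult_l_minus)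
      show "u \<oplus>\<^bsub>M\<^esub> v \<in> ?H" if "u \<in> ?H" "v \<in> ?H" for u v
        using that by (simp add: multi(2)[OF x t] S(5))
    qed (rule Collect_restrict, rule scale)
    from submodule_span_least[OF this BH] have "carrier M \<subseteq> ?H"
      unfolding assms(5) .
    moreover have "x t \<in> carrier M" using x t by auto
    ultimately show ?case by auto
  qed
  from this[of "{1..d}" x] assms(7) show ?thesis by auto
qed

lemma multilinear_map_hom:
  assumes "multilinear_map R M d N \<phi>" "module_hom R N P h"
  shows "multilinear_map R M d P (\<lambda>x. h (\<phi> x))"
proof -
  interpret module_hom R N P h by fact
  show ?thesis
    unfolding multilinear_map_def
    using multilinear_mapD[OF assms(1)] tuples_upd[of _ d "carrier M"]
    by (auto simp: hom_add hom_smult simp del: atLeastAtMost_iff)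
qed

lemma perm_tuple_upd:
  assumes "\<sigma> permutes {1..d}"
  shows "perm_tuple \<sigma> (x(t := u)) = (perm_tuple \<sigma> x)(\<sigma> t := u)"
  using permutes_inverses[OF assms] by (force simp: perm_tuple_def fun_eq_iff)

lemma perm_tuple_closed:
  assumes "\<sigma> permutes {1..d}" "x \<in> tuples d A"
  shows "perm_tuple \<sigma> x \<in> tuples d A"
  using perm_tuple_in_tuples_iff[OF permutes_inv[OF assms(1)], of x A] assms(2) by (simp add: perm_tuple_def)

lemma perm_tuple_comp:
  assumes "\<sigma> permutes S" "\<tau> permutes S"
  shows "perm_tuple (\<sigma> \<circ> \<tau>) x = perm_tuple \<sigma> (perm_tuple \<tau> x)"
  using o_inv_distrib[OF permutes_bij[OF assms(1)] permutes_bij[OF assms(2)]]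
  by (simp add: perm_tuple_def comp_assoc)

text \<open>Permuting a tuple moves the updated place \<open>t\<close> to the place \<sigma> t,
  where the given map is linear.\<close>

lemma multilinear_map_perm_tuple:
  assumes "multilinear_map R M d N \<phi>" "\<sigma> permutes {1..d}"
  shows "multilinear_map R M d N (\<lambda>x. \<phi> (perm_tuple \<sigma> x))"
  unfolding multilinear_map_def
  using multilinear_mapD[OF assms(1)] perm_tuple_closed[OF assms(2), of _ "carrier M"] permutes_in_image[OF assms(2)]
  by (auto simp: perm_tuple_upd[OF assms(2)] simp del: atLeastAtMost_iff)

lemma multilinear_map_lincomb:
  assumes "module R N" "\<And>i. i \<in> I \<Longrightarrow> multilinear_map R M d N (\<phi> i)" "a \<in> I \<rightarrow> carrier R"
    and "finite I" "module R M"
  shows "multilinear_map R M d N (\<lambda>x. \<Oplus>\<^bsub>N\<^esub>i\<in>I. a i \<odot>\<^bsub>N\<^esub> \<phi> i x)"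
proof -
  interpret M: module R M by fact
  interpret N: module R N by fact
  note multi = multilinear_mapD[OF assms(2)]
  have a: "a i \<in> carrier R" if "i \<in> I" for i using assms(3) that by auto
  have cl: "(\<lambda>i. \<phi> i x) \<in> I \<rightarrow> carrier N" "(\<lambda>i. a i \<odot>\<^bsub>N\<^esub> \<phi> i x) \<in> I \<rightarrow> carrier N"
    if "x \<in> tuples d (carrier M)" for x
    using multi(1)[OF _ that] a by auto
  show ?thesis
    unfolding multilinear_map_def
  proof (intro conjI ballI Pi_I)
    fix x assume "x \<in> tuples d (carrier M)"
    then show "(\<Oplus>\<^bsub>N\<^esub>i\<in>I. a i \<odot>\<^bsub>N\<^esub> \<phi> i x) \<in> carrier N" using cl(2) by simp
  next
    fix x t u v
    assume x: "x \<in> tuples d (carrier M)" "t \<in> {1..d}" and u: "u \<in> carrier M" and v: "v \<in> carrier M"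
    note xu = tuples_upd[OF x u] and xv = tuples_upd[OF x v]
    have "(\<Oplus>\<^bsub>N\<^esub>i\<in>I. a i \<odot>\<^bsub>N\<^esub> \<phi> i (x(t := u \<oplus>\<^bsub>M\<^esub> v))) =
        (\<Oplus>\<^bsub>N\<^esub>i\<in>I. a i \<odot>\<^bsub>N\<^esub> \<phi> i (x(t := u)) \<oplus>\<^bsub>N\<^esub> a i \<odot>\<^bsub>N\<^esub> \<phi> i (x(t := v)))"
      using cl[OF xu] cl[OF xv] a
      by (intro N.finsum_cong') (auto simp: multi(2)[OF _ x u v] Pi_iff N.smult_r_distr)
    also have "\<dots> = (\<Oplus>\<^bsub>N\<^esub>i\<in>I. a i \<odot>\<^bsub>N\<^esub> \<phi> i (x(t := u))) \<oplus>\<^bsub>N\<^esub>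
        (\<Oplus>\<^bsub>N\<^esub>i\<in>I. a i \<odot>\<^bsub>N\<^esub> \<phi> i (x(t := v)))"
      by (rule N.finsum_addf[OF cl(2)[OF xu] cl(2)[OF xv]])
    finally show "(\<Oplus>\<^bsub>N\<^esub>i\<in>I. a i \<odot>\<^bsub>N\<^esub> \<phi> i (x(t := u \<oplus>\<^bsub>M\<^esub> v))) =
      (\<Oplus>\<^bsub>N\<^esub>i\<in>I. a i \<odot>\<^bsub>N\<^esub> \<phi> i (x(t := u))) \<oplus>\<^bsub>N\<^esub> (\<Oplus>\<^bsub>N\<^esub>i\<in>I. a i \<odot>\<^bsub>N\<^esub> \<phi> i (x(t := v)))" .
  next
    fix x t u b
    assume x: "x \<in> tuples d (carrier M)" "t \<in> {1..d}" and u: "u \<in> carrier M" and b: "b \<in> carrier R"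
    note xu = tuples_upd[OF x u]
    have "(\<Oplus>\<^bsub>N\<^esub>i\<in>I. a i \<odot>\<^bsub>N\<^esub> \<phi> i (x(t := b \<odot>\<^bsub>M\<^esub> u))) =
        (\<Oplus>\<^bsub>N\<^esub>i\<in>I. b \<odot>\<^bsub>N\<^esub> (a i \<odot>\<^bsub>N\<^esub> \<phi> i (x(t := u))))"
      using cl[OF xu] a b
      by (intro N.finsum_cong')
        (auto simp: multi(3)[OF _ x u b] Pi_iff N.smult_assoc1[symmetric] M.R.m_comm)
    also have "\<dots> = b \<odot>\<^bsub>N\<^esub> (\<Oplus>\<^bsub>N\<^esub>i\<in>I. a i \<odot>\<^bsub>N\<^esub> \<phi> i (x(t := u)))"
      using assms(4) b cl(2)[OF xu] by (rule N.finsum_smult_ldistr[symmetric])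
    finally show "(\<Oplus>\<^bsub>N\<^esub>i\<in>I. a i \<odot>\<^bsub>N\<^esub> \<phi> i (x(t := b \<odot>\<^bsub>M\<^esub> u))) =
      b \<odot>\<^bsub>N\<^esub> (\<Oplus>\<^bsub>N\<^esub>i\<in>I. a i \<odot>\<^bsub>N\<^esub> \<phi> i (x(t := u)))" .
  qed
qed

text \<open>Once the factor at place \<open>t\<close> is isolated, the remaining product does not
  depend on the entry there, so linearity in that place is linearity of \<open>h t\<close>.\<close>

lemma multilinear_map_prod:
  assumes "module R M" "\<And>t. t \<in> {1..d} \<Longrightarrow> module_hom R M (regular_module R) (h t)"
  shows "multilinear_map R M d (regular_module R) (\<lambda>x. \<Otimes>\<^bsub>R\<^esub>t\<in>{1..d}. h t (x t))"
proof -
  interpret M: module R M by fact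
  have cl: "(\<lambda>t. h t (x t)) \<in> {1..d} \<rightarrow> carrier R" if "x \<in> tuples d (carrier M)" for x
    using module_hom.hom_closed[OF assms(2)] that by (auto simp: PiE_iff Pi_iff)
  have split: "(\<Otimes>\<^bsub>R\<^esub>s\<in>{1..d}. h s ((x(t := u)) s)) =
      h t u \<otimes>\<^bsub>R\<^esub> (\<Otimes>\<^bsub>R\<^esub>s\<in>{1..d} - {t}. h s (x s))"
    if "x \<in> tuples d (carrier M)" "t \<in> {1..d}" "u \<in> carrier M" for x t u
  proof -
    have "(\<Otimes>\<^bsub>R\<^esub>s\<in>insert t ({1..d} - {t}). h s ((x(t := u)) s)) =
        h t u \<otimes>\<^bsub>R\<^esub> (\<Otimes>\<^bsub>R\<^esub>s\<in>{1..d} - {t}. h s ((x(t := u)) s))"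
      using cl[OF that(1)] cl[OF tuples_upd[OF that], THEN funcset_mem, OF that(2)]
      by (subst M.R.finprod_insert) (auto simp: Pi_iff)
    also have "(\<Otimes>\<^bsub>R\<^esub>s\<in>{1..d} - {t}. h s ((x(t := u)) s)) = (\<Otimes>\<^bsub>R\<^esub>s\<in>{1..d} - {t}. h s (x s))"
      using cl[OF that(1)] by (intro M.R.finprod_cong') (auto simp: Pi_iff)
    finally show ?thesis using that(2) by (simp add: insert_absorb)
  qed
  have rest: "(\<Otimes>\<^bsub>R\<^esub>s\<in>{1..d} - {t}. h s (x s)) \<in> carrier R"
    if "x \<in> tuples d (carrier M)" for x t
    using cl[OF that] by (intro M.R.finprod_closed) auto
  show ?thesis
    unfolding multilinear_map_def
  proof (intro conjI ballI Pi_I)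
    fix x assume "x \<in> tuples d (carrier M)"
    then show "(\<Otimes>\<^bsub>R\<^esub>t\<in>{1..d}. h t (x t)) \<in> carrier (regular_module R)"
      using cl by simp
  next
    fix x t u v
    assume "x \<in> tuples d (carrier M)" "t \<in> {1..d}" "u \<in> carrier M" "v \<in> carrier M"
    then show "(\<Otimes>\<^bsub>R\<^esub>s\<in>{1..d}. h s ((x(t := u \<oplus>\<^bsub>M\<^esub> v)) s)) =
      (\<Otimes>\<^bsub>R\<^esub>s\<in>{1..d}. h s ((x(t := u)) s)) \<oplus>\<^bsub>regular_module R\<^esub>
      (\<Otimes>\<^bsub>R\<^esub>s\<in>{1..d}. h s ((x(t := v)) s))"
      using module_hom.hom_closed[OF assms(2)] module_hom.hom_add[OF assms(2)] rest
      by (simp add: split M.R.l_distr del: atLeastAtMost_iff fun_upd_apply)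
  next
    fix x t u a
    assume "x \<in> tuples d (carrier M)" "t \<in> {1..d}" "u \<in> carrier M" "a \<in> carrier R"
    then show "(\<Otimes>\<^bsub>R\<^esub>s\<in>{1..d}. h s ((x(t := a \<odot>\<^bsub>M\<^esub> u)) s)) =
      a \<odot>\<^bsub>regular_module R\<^esub> (\<Otimes>\<^bsub>R\<^esub>s\<in>{1..d}. h s ((x(t := u)) s))"
      using module_hom.hom_closed[OF assms(2)] module_hom.hom_smult[OF assms(2)] rest
      by (simp add: split M.R.m_assoc del: atLeastAtMost_iff fun_upd_apply)
  qed
qed


section \<open>The universal property of tensor powers\<close>

lemma tensor_power_proj:
  assumes "module R M"
  shows "module_hom R (free_module R (tuples d (carrier M))) (tensor_power R M d)
    (\<lambda>f. tensor_null R M d +>\<^bsub>free_module R (tuples d (carrier M))\<^esub> f)"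
  unfolding tensor_power_def
  using assms module.axioms(1)[OF assms]
  by (intro module_hom_quot_module module_free_module submodule_tensor_null)

text \<open>Pull \<open>S\<close> back along the projection from the free module, where generation
  by the free generators is already known.\<close>

lemma tensor_power_generated:
  assumes "module R M" "submodule S R (tensor_power R M d)"
    and "\<And>x. x \<in> tuples d (carrier M) \<Longrightarrow> tensor R M d x \<in> S"
    and "z \<in> carrier (tensor_power R M d)"
  shows "z \<in> S"
proof -
  let ?X = "tuples d (carrier M)"
  interpret p: module_hom R "free_module R ?X" "tensor_power R M d"
    "\<lambda>f. tensor_null R M d +>\<^bsub>free_module R ?X\<^esub> f"
    by (rule tensor_power_proj) fact
  obtain f where f: "f \<in> carrier (free_module R ?X)"
    "z = tensor_null R M d +>\<^bsub>free_module R ?X\<^esub> f"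
    using assms(4) by (auto simp: tensor_power_def carrier_quot_module)
  have "f \<in> {f \<in> carrier (free_module R ?X). tensor_null R M d +>\<^bsub>free_module R ?X\<^esub> f \<in> S}"
    using assms(3) f(1) free_gen_closed[OF p.M.is_cring]
    by (intro free_module_generated[OF p.M.is_cring p.submodule_vimage[OF assms(2)]])
      (auto simp: tensor_def)
  then show ?thesis using f(2) by simp
qed

text \<open>The elements of \<open>multilinear_rels\<close> are exactly the differences that have to
  vanish for the two multilinearity equations.\<close>

lemma multilinear_map_tensor:
  assumes "module R M"
  shows "multilinear_map R M d (tensor_power R M d) (tensor R M d)"
proof -
  let ?X = "tuples d (carrier M)"
  let ?F = "free_module R ?X"
  interpret p: module_hom R ?F "tensor_power R M d" "\<lambda>f. tensor_null R M d +>\<^bsub>?F\<^esub> f"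
    by (rule tensor_power_proj) fact
  note gen = free_gen_closed[OF p.M.is_cring, of ?X]
  have eq: "tensor_null R M d +>\<^bsub>?F\<^esub> f = tensor_null R M d +>\<^bsub>?F\<^esub> g"
    if "f \<ominus>\<^bsub>?F\<^esub> g \<in> multilinear_rels R M d" "f \<in> carrier ?F" "g \<in> carrier ?F" for f g
  proof -
    have "f \<ominus>\<^bsub>?F\<^esub> g \<in> tensor_null R M d"
      using that(1) submodule_span_superset[of _ R ?F] unfolding tensor_null_def by auto
    then have "tensor_null R M d +>\<^bsub>?F\<^esub> (f \<ominus>\<^bsub>?F\<^esub> g) = \<zero>\<^bsub>tensor_power R M d\<^esub>"
      using that(2,3) unfolding tensor_power_def
      by (subst quot_module_eq_zero_iff[OF p.M.module_axioms submodule_tensor_null[OF assms]]) auto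
    then show ?thesis
      using that(2,3) by (simp add: p.hom_minus p.N.minus_eq_zero_iff)
  qed
  show ?thesis
    unfolding multilinear_map_def
  proof (intro conjI ballI Pi_I)
    fix x show "tensor R M d x \<in> carrier (tensor_power R M d)"
      by (simp add: tensor_def gen)
  next
    fix x t u v
    assume "x \<in> ?X" "t \<in> {1..d}" "u \<in> carrier M" "v \<in> carrier M"
    then have "tensor R M d (x(t := u \<oplus>\<^bsub>M\<^esub> v)) = tensor_null R M d +>\<^bsub>?F\<^esub>
        (free_gen R ?X (x(t := u)) \<oplus>\<^bsub>?F\<^esub> free_gen R ?X (x(t := v)))"
      unfolding tensor_def
      by (intro eq gen p.M.a_closed) (auto simp: multilinear_rels_def Let_def)
    then show "tensor R M d (x(t := u \<oplus>\<^bsub>M\<^esub> v)) =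
      tensor R M d (x(t := u)) \<oplus>\<^bsub>tensor_power R M d\<^esub> tensor R M d (x(t := v))"
      by (simp add: tensor_def p.hom_add gen)
  next
    fix x t u a
    assume *: "x \<in> ?X" "t \<in> {1..d}" "u \<in> carrier M" "a \<in> carrier R"
    then have "tensor R M d (x(t := a \<odot>\<^bsub>M\<^esub> u)) = tensor_null R M d +>\<^bsub>?F\<^esub>
        (a \<odot>\<^bsub>?F\<^esub> free_gen R ?X (x(t := u)))"
      unfolding tensor_def
      by (intro eq gen p.M.smult_closed) (auto simp: multilinear_rels_def Let_def)
    then show "tensor R M d (x(t := a \<odot>\<^bsub>M\<^esub> u)) =
      a \<odot>\<^bsub>tensor_power R M d\<^esub> tensor R M d (x(t := u))"
      using *(4) by (simp add: tensor_def p.hom_smult gen)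
  qed
qed

text \<open>The linear extension of \<phi> to the free module kills the multilinearity relations
  because \<phi> is multilinear. Its kernel is a submodule, so it kills their span and factors
  through the quotient.\<close>

lemma tensor_power_lift:
  assumes "module R M" "module R N" "multilinear_map R M d N \<phi>"
  obtains g where "module_hom R (tensor_power R M d) N g"
    "\<And>x. x \<in> tuples d (carrier M) \<Longrightarrow> g (tensor R M d x) = \<phi> x"
proof -
  let ?X = "tuples d (carrier M)"
  let ?F = "free_module R ?X" and ?h = "linear_extension R N ?X \<phi>"
  have \<phi>: "\<phi> \<in> ?X \<rightarrow> carrier N" using assms(3) by (simp add: multilinear_map_def)
  interpret h: module_hom R ?F N ?h by (rule module_hom_linear_extension[OF assms(2) \<phi>])
  note multi = multilinear_mapD[OF assms(3)]
  note gen = free_gen_closed[OF h.M.is_cring, of ?X]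
  have h: "?h (free_gen R ?X x) = \<phi> x" if "x \<in> ?X" for x
    by (rule linear_extension_free_gen[OF assms(2) \<phi> that])
  have M: "u \<oplus>\<^bsub>M\<^esub> v \<in> carrier M" "a \<odot>\<^bsub>M\<^esub> u \<in> carrier M"
    if "u \<in> carrier M" "v \<in> carrier M" "a \<in> carrier R" for u v a
    using that assms(1) by (simp_all add: module.smult_closed abelian_groupE(1) module.axioms(2))
  have "multilinear_rels R M d \<subseteq> {f \<in> carrier ?F. ?h f \<in> {\<zero>\<^bsub>N\<^esub>}}"
  proof
    fix f assume f: "f \<in> multilinear_rels R M d"
    then consider
      (add) x t u v where "x \<in> ?X" "t \<in> {1..d}" "u \<in> carrier M" "v \<in> carrier M"
        "f = free_gen R ?X (x(t := u \<oplus>\<^bsub>M\<^esub> v)) \<ominus>\<^bsub>?F\<^esub>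
          (free_gen R ?X (x(t := u)) \<oplus>\<^bsub>?F\<^esub> free_gen R ?X (x(t := v)))"
    | (smult) x t a u where "x \<in> ?X" "t \<in> {1..d}" "a \<in> carrier R" "u \<in> carrier M"
        "f = free_gen R ?X (x(t := a \<odot>\<^bsub>M\<^esub> u)) \<ominus>\<^bsub>?F\<^esub> a \<odot>\<^bsub>?F\<^esub> free_gen R ?X (x(t := u))"
      unfolding multilinear_rels_def Let_def by blast
    then have "?h f = \<zero>\<^bsub>N\<^esub>"
    proof cases
      case add
      then show ?thesis
        using M(1)[OF add(3,4) h.M.R.zero_closed] multi(1)
        by (simp add: h.hom_minus h.hom_add gen h tuples_upd multi(2) h.N.minus_eq_zero_iff
            del: atLeastAtMost_iff)
    next
      case smult
      then show ?thesis
        using M(2)[OF smult(4,4,3)] multi(1)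
        by (simp add: h.hom_minus h.hom_smult gen h tuples_upd multi(3) h.N.minus_eq_zero_iff
            del: atLeastAtMost_iff)
    qed
    then show "f \<in> {f \<in> carrier ?F. ?h f \<in> {\<zero>\<^bsub>N\<^esub>}}"
      using f multilinear_rels_subset[OF assms(1)] by blast
  qed
  then have "tensor_null R M d \<subseteq> {f \<in> carrier ?F. ?h f \<in> {\<zero>\<^bsub>N\<^esub>}}"
    unfolding tensor_null_def
    by (intro submodule_span_least h.submodule_vimage h.N.submodule_zero)
  then obtain g where "module_hom R (tensor_power R M d) N g"
    "\<And>f. f \<in> carrier ?F \<Longrightarrow> g (tensor_null R M d +>\<^bsub>?F\<^esub> f) = ?h f"
    unfolding tensor_power_def
    using quot_module_lift[OF h.module_hom_axioms submodule_tensor_null[OF assms(1)]] by blast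
  then show thesis
    using that gen h by (simp add: tensor_def)
qed


section \<open>Semi-symmetric powers\<close>

text \<open>Translating the summation variable by \<open>g\<close> shows that the sum is unchanged
  when multiplied by \<open>\<chi> g\<close>. If it were nonzero, cancelling it in the domain would
  force \<open>\<chi> g\<close> to be one.\<close>

lemma (in domain) sum_character_eq_zero:
  assumes "group G" "finite (carrier G)" "\<chi> \<in> hom G (units_of R)" "g \<in> carrier G" "\<chi> g \<noteq> \<one>"
  shows "(\<Oplus>x\<in>carrier G. \<chi> x) = \<zero>"
proof (rule ccontr)
  interpret G: group G by fact
  let ?s = "\<Oplus>x\<in>carrier G. \<chi> x"
  assume s0: "?s \<noteq> \<zero>"
  have \<chi>: "\<chi> x \<in> carrier R" if "x \<in> carrier G" for x
    using hom_in_carrier[OF assms(3) that] by (auto simp: units_of_carrier)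
  then have s: "?s \<in> carrier R" by (intro finsum_closed) auto
  have "?s = (\<Oplus>x\<in>(\<lambda>x. g \<otimes>\<^bsub>G\<^esub> x) ` carrier G. \<chi> x)"
    using G.surj_const_mult[OF assms(4)] by simp
  also have "\<dots> = (\<Oplus>x\<in>carrier G. \<chi> (g \<otimes>\<^bsub>G\<^esub> x))"
    using \<chi> assms(4) G.inj_on_cmult[OF assms(4)] by (intro finsum_reindex) auto
  also have "\<dots> = (\<Oplus>x\<in>carrier G. \<chi> g \<otimes> \<chi> x)"
    using \<chi> assms(4) hom_mult[OF assms(3)]
    by (intro finsum_cong') (auto simp: units_of_mult)
  also have "\<dots> = \<chi> g \<otimes> ?s"
    using \<chi> assms(2,4) by (intro finsum_rdistr[symmetric]) auto
  finally have "\<chi> g \<otimes> ?s = \<one> \<otimes> ?s" using s by simp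
  then show False
    using m_rcancel[of ?s "\<chi> g" \<one>] s s0 \<chi>[OF assms(4)] assms(5) by simp
qed

lemma (in cring) finsum_one: "finite A \<Longrightarrow> (\<Oplus>x\<in>A. \<one>) = [card A] \<cdot> \<one>"
  by (rule add.finprod_const) simp

lemma (in cring) Units_add_pow_dvd:
  assumes "[n] \<cdot> \<one> \<in> Units R" "m dvd (n :: nat)"
  shows "[m] \<cdot> \<one> \<in> Units R"
proof -
  obtain k where "n = m * k" using assms(2) by blast
  then have "[n] \<cdot> \<one> = [m] \<cdot> \<one> \<otimes> [k] \<cdot> \<one>"
    by (simp add: add_pow_ldistr add.nat_pow_pow mult.commute)
  then show ?thesis
    using assms(1) unit_factor[of "[m] \<cdot> \<one>" "[k] \<cdot> \<one>"] by simp
qed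

lemma (in cring) finprod_delta:
  assumes "finite A"
  shows "(\<Otimes>t\<in>A. if P t then \<one> else \<zero>) = (if \<forall>t\<in>A. P t then \<one> else \<zero>)"
  using assms by (induction A) (auto simp: Pi_def)

section \<open>The semi-symmetric power and its universal property\<close>

locale semi_symmetric = M: module R M
  for R :: "('k, 'r) ring_scheme" and M :: "('k, 'e, 'm) module_scheme" +
  fixes d :: nat and W :: "(nat \<Rightarrow> nat) set" and \<chi> :: "(nat \<Rightarrow> nat) \<Rightarrow> 'k"
  assumes W: "subgroup W (sym_group d)" and \<chi>: "\<chi> \<in> hom (perm_group d W) (units_of R)"
begin

abbreviation "T \<equiv> tensor_power R M d"
abbreviation "Q \<equiv> semi_sym_power R M d W \<chi>"
abbreviation "sym_prod \<equiv> semi_sym_prod R M d W \<chi>"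
abbreviation "stab \<equiv> stabilizer (perm_group d W) perm_tuple"

lemma W_permutes: "\<sigma> \<in> W \<Longrightarrow> \<sigma> permutes {1..d}"
  using subgroup.subset[OF W] by (auto simp: sym_group_carrier)

lemma W_subset: "W \<subseteq> carrier (sym_group d)"
  by (rule subgroup.subset[OF W])

lemma W_comp: "\<lbrakk>\<sigma> \<in> W; \<tau> \<in> W\<rbrakk> \<Longrightarrow> \<sigma> \<circ> \<tau> \<in> W"
  using subgroup.m_closed[OF W] by (simp add: sym_group_mult)

lemma W_inv: "\<sigma> \<in> W \<Longrightarrow> inv' \<sigma> \<in> W"
  using subgroup.m_inv_closed[OF W] W_subset by (metis subsetD sym_group_inv_equality)

lemma W_id: "id \<in> W"
  using subgroup.one_closed[OF W] by (simp add: sym_group_one)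

lemma finite_W: "finite W"
proof (rule finite_subset)
  show "W \<subseteq> {\<sigma>. \<sigma> permutes {1..d}}" using W_permutes by blast
qed (simp add: finite_permutations)

lemma group_W: "group (perm_group d W)"
  by (rule subgroup.subgroup_is_group[OF W sym_group_is_group])

lemma char_Units [simp]: "\<sigma> \<in> W \<Longrightarrow> \<chi> \<sigma> \<in> Units R"
  using hom_in_carrier[OF \<chi>] by (simp add: units_of_carrier)

lemma char_closed [simp]: "\<sigma> \<in> W \<Longrightarrow> \<chi> \<sigma> \<in> carrier R"
  by (rule M.Units_closed) simp

lemma char_comp: "\<lbrakk>\<sigma> \<in> W; \<tau> \<in> W\<rbrakk> \<Longrightarrow> \<chi> (\<sigma> \<circ> \<tau>) = \<chi> \<sigma> \<otimes>\<^bsub>R\<^esub> \<chi> \<tau>"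
  using hom_mult[OF \<chi>] by (simp add: units_of_mult sym_group_mult)

lemma module_T: "module R T"
  by (rule module_tensor_power) (rule M.module_axioms)

lemma module_Q: "module R Q"
  by (rule module_semi_sym_power[OF M.module_axioms W_subset]) simp

lemma submodule_null: "submodule (semi_sym_null R M d W \<chi>) R T"
proof -
  interpret T: module R T by (rule module_T)
  show ?thesis
    unfolding semi_sym_null_def Let_def
    by (rule submodule_submodule_span[OF module_T])
      (auto intro!: T.M.minus_closed T.smult_closed perm_tensor_closed[OF M.module_axioms W_permutes])
qed

lemma proj_hom: "module_hom R T Q (\<lambda>z. semi_sym_null R M d W \<chi> +>\<^bsub>T\<^esub> z)"
  unfolding semi_sym_power_def by (rule module_hom_quot_module[OF module_T submodule_null])

lemma multilinear_sym_prod: "multilinear_map R M d Q sym_prod"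
  using multilinear_map_hom[OF multilinear_map_tensor[OF M.module_axioms] proj_hom]
  by (simp add: semi_sym_prod_def[abs_def])

text \<open>This is a defining relation of \<open>semi_sym_null\<close>, taken at a pure tensor and
  read in the quotient. The factor is the inverse of \<open>\<chi> \<sigma>\<close> because
  \<open>perm_tuple \<sigma>\<close> composes with \<open>inv' \<sigma>\<close>.\<close>

lemma sym_prod_perm_tuple:
  assumes "\<sigma> \<in> W" "x \<in> tuples d (carrier M)"
  shows "sym_prod (perm_tuple \<sigma> x) = inv\<^bsub>R\<^esub> \<chi> \<sigma> \<odot>\<^bsub>Q\<^esub> sym_prod x"
proof -
  interpret p: module_hom R T Q "\<lambda>z. semi_sym_null R M d W \<chi> +>\<^bsub>T\<^esub> z" by (rule proj_hom)
  let ?t = "tensor R M d x"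
  note perm = W_permutes[OF assms(1)]
  have t: "?t \<in> carrier T" "perm_tensor \<sigma> ?t \<in> carrier T"
    using multilinear_mapD(1)[OF multilinear_map_tensor[OF M.module_axioms] assms(2)]
      perm_tensor_closed[OF M.module_axioms perm] by auto
  have c: "inv\<^bsub>R\<^esub> \<chi> \<sigma> \<in> carrier R" using assms(1) by simp
  have "inv\<^bsub>R\<^esub> \<chi> \<sigma> \<odot>\<^bsub>T\<^esub> ?t \<ominus>\<^bsub>T\<^esub> perm_tensor \<sigma> ?t \<in> semi_sym_null R M d W \<chi>"
    unfolding semi_sym_null_def Let_def
    by (rule subsetD[OF submodule_span_superset]) (use assms(1) t(1) in blast)
  then have "semi_sym_null R M d W \<chi> +>\<^bsub>T\<^esub> (inv\<^bsub>R\<^esub> \<chi> \<sigma> \<odot>\<^bsub>T\<^esub> ?t \<ominus>\<^bsub>T\<^esub> perm_tensor \<sigma> ?t) = \<zero>\<^bsub>Q\<^esub>"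
    unfolding semi_sym_power_def
    using quot_module_eq_zero_iff[OF module_T submodule_null] t c by simp
  then show ?thesis
    using t c
    by (simp add: p.hom_minus p.hom_smult p.N.minus_eq_zero_iff semi_sym_prod_def
        perm_tensor_tensor[OF M.module_axioms perm])
qed

lemma Q_generated:
  assumes "submodule S R Q" "\<And>x. x \<in> tuples d (carrier M) \<Longrightarrow> sym_prod x \<in> S" "z \<in> carrier Q"
  shows "z \<in> S"
proof -
  interpret p: module_hom R T Q "\<lambda>z. semi_sym_null R M d W \<chi> +>\<^bsub>T\<^esub> z" by (rule proj_hom)
  obtain w where w: "w \<in> carrier T" "z = semi_sym_null R M d W \<chi> +>\<^bsub>T\<^esub> w"
    using assms(3) by (auto simp: semi_sym_power_def carrier_quot_module)
  have "w \<in> {w \<in> carrier T. semi_sym_null R M d W \<chi> +>\<^bsub>T\<^esub> w \<in> S}"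
    by (rule tensor_power_generated[OF M.module_axioms p.submodule_vimage[OF assms(1)] _ w(1)])
      (use assms(2) multilinear_mapD(1)[OF multilinear_map_tensor[OF M.module_axioms]]
        in \<open>simp add: semi_sym_prod_def\<close>)
  then show ?thesis using w(2) by simp
qed

text \<open>The universal property of the tensor power gives a linear map \<open>h\<close>. Since
  \<phi> transforms by the inverse of \<chi>, \<open>h\<close> kills the generators of
  \<open>semi_sym_null\<close> and descends once more.\<close>

lemma semi_sym_power_lift:
  assumes "module R N" "multilinear_map R M d N \<phi>"
    and "\<And>\<sigma> x. \<lbrakk>\<sigma> \<in> W; x \<in> tuples d (carrier M)\<rbrakk> \<Longrightarrow>
      \<phi> (perm_tuple \<sigma> x) = inv\<^bsub>R\<^esub> \<chi> \<sigma> \<odot>\<^bsub>N\<^esub> \<phi> x"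
  obtains g where "module_hom R Q N g" "\<And>x. x \<in> tuples d (carrier M) \<Longrightarrow> g (sym_prod x) = \<phi> x"
proof -
  obtain h where hom: "module_hom R T N h"
    and h: "\<And>x. x \<in> tuples d (carrier M) \<Longrightarrow> h (tensor R M d x) = \<phi> x"
    using tensor_power_lift[OF M.module_axioms assms(1,2)] by blast
  interpret h: module_hom R T N h by (rule hom)
  have tensor: "tensor R M d x \<in> carrier T" if "x \<in> tuples d (carrier M)" for x
    using multilinear_mapD(1)[OF multilinear_map_tensor[OF M.module_axioms] that] .
  \<comment> \<open>Equivariance is assumed on tuples only, that is, on pure tensors. Both sides are
    linear in \<open>z\<close> and pure tensors generate \<open>T\<close>, so it holds for every
    \<open>z\<close>.\<close>
  have "h (perm_tensor \<sigma> z) = inv\<^bsub>R\<^esub> \<chi> \<sigma> \<odot>\<^bsub>N\<^esub> h z" if \<sigma>: "\<sigma> \<in> W" and z: "z \<in> carrier T" for \<sigma> z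
  proof -
    note perm = W_permutes[OF \<sigma>]
    have "module_hom R T N (\<lambda>z. h (perm_tensor \<sigma> z))"
      using perm_tensor_closed[OF M.module_axioms perm] perm_tensor_add[OF M.module_axioms perm]
        perm_tensor_smult[OF M.module_axioms perm]
      by unfold_locales (simp_all add: h.hom_add h.hom_smult)
    moreover have "module_hom R T N (\<lambda>z. inv\<^bsub>R\<^esub> \<chi> \<sigma> \<odot>\<^bsub>N\<^esub> h z)"
      using \<sigma>
      by unfold_locales
        (simp_all add: h.hom_add h.hom_smult h.N.smult_r_distr M.m_comm
          h.N.smult_assoc1[symmetric])
    ultimately have "submodule {z \<in> carrier T. h (perm_tensor \<sigma> z) = inv\<^bsub>R\<^esub> \<chi> \<sigma> \<odot>\<^bsub>N\<^esub> h z} R T"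
      by (rule submodule_equalizer)
    then have "z \<in> {z \<in> carrier T. h (perm_tensor \<sigma> z) = inv\<^bsub>R\<^esub> \<chi> \<sigma> \<odot>\<^bsub>N\<^esub> h z}"
      by (rule tensor_power_generated[OF M.module_axioms _ _ z])
        (simp add: tensor h perm_tensor_tensor[OF M.module_axioms perm] perm_tuple_closed[OF perm]
          assms(3)[OF \<sigma>])
    then show ?thesis by simp
  qed
  then have "semi_sym_null R M d W \<chi> \<subseteq> {z \<in> carrier T. h z \<in> {\<zero>\<^bsub>N\<^esub>}}"
    unfolding semi_sym_null_def Let_def
    using perm_tensor_closed[OF M.module_axioms W_permutes]
    by (intro submodule_span_least h.submodule_vimage h.N.submodule_zero)
      (auto simp: h.hom_minus h.hom_smult h.N.minus_eq_zero_iff)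
  then obtain g where "module_hom R Q N g"
    "\<And>z. z \<in> carrier T \<Longrightarrow> g (semi_sym_null R M d W \<chi> +>\<^bsub>T\<^esub> z) = h z"
    unfolding semi_sym_power_def
    using quot_module_lift[OF hom submodule_null] by blast
  then show thesis
    using that h tensor by (simp add: semi_sym_prod_def)
qed

section \<open>Symmetrization of multilinear maps\<close>

text \<open>An averaging operator twisted by \<chi>, without division by the order of
  \<open>W\<close>.\<close>

definition symmetrize :: "('k, 'f, 'n) module_scheme \<Rightarrow> ((nat \<Rightarrow> 'e) \<Rightarrow> 'f) \<Rightarrow> (nat \<Rightarrow> 'e) \<Rightarrow> 'f"
  where "symmetrize N \<phi> x = (\<Oplus>\<^bsub>N\<^esub>\<sigma>\<in>W. \<chi> \<sigma> \<odot>\<^bsub>N\<^esub> \<phi> (perm_tuple \<sigma> x))"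

lemma multilinear_symmetrize:
  assumes "module R N" "multilinear_map R M d N \<phi>"
  shows "multilinear_map R M d N (symmetrize N \<phi>)"
  unfolding symmetrize_def[abs_def]
  using W_permutes
  by (intro multilinear_map_lincomb multilinear_map_perm_tuple assms M.module_axioms finite_W) auto

lemma symmetrize_perm_tuple:
  assumes "module R N" "multilinear_map R M d N \<phi>" "\<tau> \<in> W" "x \<in> tuples d (carrier M)"
  shows "symmetrize N \<phi> (perm_tuple \<tau> x) = inv\<^bsub>R\<^esub> \<chi> \<tau> \<odot>\<^bsub>N\<^esub> symmetrize N \<phi> x"
proof -
  interpret N: module R N by fact
  have cl: "\<phi> (perm_tuple \<sigma> x) \<in> carrier N" if "\<sigma> \<in> W" for \<sigma>
    using multilinear_mapD(1)[OF assms(2) perm_tuple_closed[OF W_permutes[OF that] assms(4)]] .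
  have comp: "perm_tuple (\<sigma> \<circ> \<tau>) x = perm_tuple \<sigma> (perm_tuple \<tau> x)" if "\<sigma> \<in> W" for \<sigma>
    using perm_tuple_comp[OF W_permutes[OF that] W_permutes[OF assms(3)]] .
  have cl': "\<phi> (perm_tuple \<sigma> (perm_tuple \<tau> x)) \<in> carrier N" if "\<sigma> \<in> W" for \<sigma>
    using cl[OF W_comp[OF that assms(3)]] comp[OF that] by simp
  have sym: "symmetrize N \<phi> (perm_tuple \<tau> x) \<in> carrier N"
    unfolding symmetrize_def using cl' by (intro N.finsum_closed) auto
  have bij: "(\<lambda>\<sigma>. \<sigma> \<circ> \<tau>) ` W = W" "inj_on (\<lambda>\<sigma>. \<sigma> \<circ> \<tau>) W"
  proof -
    have "\<sigma> = (\<sigma> \<circ> inv' \<tau>) \<circ> \<tau>" "\<sigma> = (\<sigma> \<circ> \<tau>) \<circ> inv' \<tau>" for \<sigma> :: "nat \<Rightarrow> nat"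
      using permutes_inv_o[OF W_permutes[OF assms(3)]] by (simp_all add: comp_assoc)
    then show "(\<lambda>\<sigma>. \<sigma> \<circ> \<tau>) ` W = W" "inj_on (\<lambda>\<sigma>. \<sigma> \<circ> \<tau>) W"
      using W_comp W_inv assms(3) by (auto intro!: inj_on_inverseI[of _ "\<lambda>\<sigma>. \<sigma> \<circ> inv' \<tau>"]) blast
  qed
  \<comment> \<open>The computation starts from the value at \<open>x\<close>: replacing \<sigma> by
    \<open>\<sigma> \<circ> \<tau>\<close> produces the factor \<open>\<chi> \<tau>\<close> in front
    of the value at \<open>perm_tuple \<tau> x\<close>, and this unit is inverted at the
    end.\<close>
  have "symmetrize N \<phi> x = (\<Oplus>\<^bsub>N\<^esub>\<sigma>\<in>(\<lambda>\<sigma>. \<sigma> \<circ> \<tau>) ` W. \<chi> \<sigma> \<odot>\<^bsub>N\<^esub> \<phi> (perm_tuple \<sigma> x))"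
    by (simp add: symmetrize_def bij(1))
  also have "\<dots> = (\<Oplus>\<^bsub>N\<^esub>\<sigma>\<in>W. \<chi> (\<sigma> \<circ> \<tau>) \<odot>\<^bsub>N\<^esub> \<phi> (perm_tuple (\<sigma> \<circ> \<tau>) x))"
    using cl bij by (intro N.finsum_reindex) auto
  also have "\<dots> = (\<Oplus>\<^bsub>N\<^esub>\<sigma>\<in>W. \<chi> \<tau> \<odot>\<^bsub>N\<^esub> (\<chi> \<sigma> \<odot>\<^bsub>N\<^esub> \<phi> (perm_tuple \<sigma> (perm_tuple \<tau> x))))"
    using cl' assms(3)
    by (intro N.finsum_cong') (auto simp: char_comp comp N.smult_assoc1[symmetric] M.m_comm)
  also have "\<dots> = \<chi> \<tau> \<odot>\<^bsub>N\<^esub> symmetrize N \<phi> (perm_tuple \<tau> x)"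
    unfolding symmetrize_def using cl' assms(3) finite_W
    by (intro N.finsum_smult_ldistr[symmetric]) auto
  finally show ?thesis
    using sym assms(3) by (simp add: N.smult_assoc1[symmetric])
qed

section \<open>Stabilizers and vanishing products\<close>

text \<open>Supplies both the divisibility of \<open>card W\<close> by the order of the stabilizer
  and a group on which \<chi> has a character sum.\<close>

lemma subgroup_stab: "subgroup (stab i) (perm_group d W)"
proof (rule group.subgroupI[OF group_W])
  show "stab i \<noteq> {}"
    using W_id by (auto simp: stabilizer_def perm_tuple_def)
next
  fix \<sigma> \<tau> assume "\<sigma> \<in> stab i" "\<tau> \<in> stab i"
  then show "\<sigma> \<otimes>\<^bsub>perm_group d W\<^esub> \<tau> \<in> stab i"
    using W_comp perm_tuple_comp[OF W_permutes W_permutes, of \<sigma> \<tau> i]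
    by (simp add: stabilizer_def sym_group_mult)
next
  fix \<sigma> assume \<sigma>: "\<sigma> \<in> stab i"
  then have "\<sigma> \<in> W" by (simp add: stabilizer_def)
  then have "inv\<^bsub>perm_group d W\<^esub> \<sigma> = inv' \<sigma>"
    using group.m_inv_consistent[OF sym_group_is_group W] W_subset
    by (metis subsetD sym_group_inv_equality)
  moreover have "perm_tuple (inv' \<sigma>) i = i"
  proof -
    have "i = i \<circ> inv' \<sigma>" using \<sigma> by (simp add: stabilizer_def perm_tuple_def)
    then have "i \<circ> \<sigma> = i"
      using permutes_inv_o(2)[OF W_permutes[OF \<open>\<sigma> \<in> W\<close>]] by (metis comp_assoc comp_id)
    then show ?thesis
      using permutes_inv_inv[OF W_permutes[OF \<open>\<sigma> \<in> W\<close>]] by (simp add: perm_tuple_def)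
  qed
  ultimately show "inv\<^bsub>perm_group d W\<^esub> \<sigma> \<in> stab i"
    using W_inv[OF \<open>\<sigma> \<in> W\<close>] by (simp add: stabilizer_def)
qed (auto simp: stabilizer_def)

lemma stab_subset: "stab i \<subseteq> W"
  by (auto simp: stabilizer_def)

text \<open>By Lagrange the order of the stabilizer divides that of \<open>W\<close>. It is
  cancelled twice below: to make products vanish, and to recover coefficients in the independence
  proof.\<close>

lemma card_stab_Units:
  assumes "[card W] \<cdot>\<^bsub>R\<^esub> \<one>\<^bsub>R\<^esub> \<in> Units R"
  shows "[card (stab i)] \<cdot>\<^bsub>R\<^esub> \<one>\<^bsub>R\<^esub> \<in> Units R"
proof (rule M.Units_add_pow_dvd[OF assms])
  show "card (stab i) dvd card W"
    using group.lagrange[OF group_W subgroup_stab[of i], symmetric] by (simp add: order_def)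
qed

lemma sym_prod_eq_zero:
  assumes "domain R" "[card W] \<cdot>\<^bsub>R\<^esub> \<one>\<^bsub>R\<^esub> \<in> Units R" "x \<in> tuples d (carrier M)"
    and "\<sigma> \<in> stab x" "\<chi> \<sigma> \<noteq> \<one>\<^bsub>R\<^esub>"
  shows "sym_prod x = \<zero>\<^bsub>Q\<^esub>"
proof -
  interpret R: domain R by fact
  interpret Q: module R Q by (rule module_Q)
  have px: "sym_prod x \<in> carrier Q" by (rule multilinear_mapD(1)[OF multilinear_sym_prod assms(3)])
  have fin: "finite (stab x)" using stab_subset[of x] finite_W by (rule finite_subset)
  \<comment> \<open>As \<tau> fixes \<open>x\<close>, the transformation rule equates
    \<open>sym_prod x\<close> with its multiple by the inverse of
    \<open>\<chi> \<tau>\<close>.\<close>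
  have fix_prod: "\<chi> \<tau> \<odot>\<^bsub>Q\<^esub> sym_prod x = sym_prod x" if "\<tau> \<in> stab x" for \<tau>
  proof -
    have \<tau>: "\<tau> \<in> W" "perm_tuple \<tau> x = x" using that by (auto simp: stabilizer_def)
    have "\<chi> \<tau> \<odot>\<^bsub>Q\<^esub> sym_prod x = \<chi> \<tau> \<odot>\<^bsub>Q\<^esub> (inv\<^bsub>R\<^esub> \<chi> \<tau> \<odot>\<^bsub>Q\<^esub> sym_prod x)"
      using sym_prod_perm_tuple[OF \<tau>(1) assms(3)] \<tau>(2) by simp
    then show ?thesis using px \<tau>(1) by (simp add: Q.smult_assoc1[symmetric])
  qed
  \<comment> \<open>Viewing scaling of the fixed vector as a linear map of the scalar lets
    \<open>hom_finsum\<close> move sums of scalars in and out.\<close>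
  have hom: "module_hom R (regular_module R) Q (\<lambda>a. a \<odot>\<^bsub>Q\<^esub> sym_prod x)"
    using px module_regular_module[OF M.is_cring] module_Q
    by (intro module_hom.intro module_hom_axioms.intro)
      (auto simp: Q.smult_l_distr Q.smult_assoc1)
  have "group ((perm_group d W)\<lparr>carrier := stab x\<rparr>)"
    using subgroup.subgroup_is_group[OF subgroup_stab group_W] .
  moreover have "\<chi> \<in> hom ((perm_group d W)\<lparr>carrier := stab x\<rparr>) (units_of R)"
    using \<chi> stab_subset[of x] by (auto simp: hom_def)
  ultimately have "(\<Oplus>\<^bsub>R\<^esub>\<tau>\<in>stab x. \<chi> \<tau>) = \<zero>\<^bsub>R\<^esub>"
    using R.sum_character_eq_zero[of "(perm_group d W)\<lparr>carrier := stab x\<rparr>" \<chi> \<sigma>] assms(4,5) fin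
    by simp
  moreover have \<chi>_stab: "\<chi> \<in> stab x \<rightarrow> carrier R"
    using stab_subset[of x] by auto
  ultimately have "\<zero>\<^bsub>Q\<^esub> = (\<Oplus>\<^bsub>R\<^esub>\<tau>\<in>stab x. \<chi> \<tau>) \<odot>\<^bsub>Q\<^esub> sym_prod x"
    using px by simp
  also have "\<dots> = (\<Oplus>\<^bsub>Q\<^esub>\<tau>\<in>stab x. \<chi> \<tau> \<odot>\<^bsub>Q\<^esub> sym_prod x)"
    using module_hom.hom_finsum[OF hom, of \<chi> "stab x"] \<chi>_stab by simp
  \<comment> \<open>From here the sum is evaluated a second time: by \<open>fix_prod\<close> each
    term equals \<open>sym_prod x\<close>, so the total is the order of the stabilizer times that
    vector.\<close>
  also have "\<dots> = (\<Oplus>\<^bsub>Q\<^esub>\<tau>\<in>stab x. \<one>\<^bsub>R\<^esub> \<odot>\<^bsub>Q\<^esub> sym_prod x)"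
    using px by (intro Q.finsum_cong') (auto simp: fix_prod)
  also have "\<dots> = (\<Oplus>\<^bsub>R\<^esub>\<tau>\<in>stab x. \<one>\<^bsub>R\<^esub>) \<odot>\<^bsub>Q\<^esub> sym_prod x"
    using module_hom.hom_finsum[OF hom, of "\<lambda>_. \<one>\<^bsub>R\<^esub>" "stab x"] by auto
  also have "\<dots> = ([card (stab x)] \<cdot>\<^bsub>R\<^esub> \<one>\<^bsub>R\<^esub>) \<odot>\<^bsub>Q\<^esub> sym_prod x"
    by (simp add: M.finsum_one fin)
  finally have z: "([card (stab x)] \<cdot>\<^bsub>R\<^esub> \<one>\<^bsub>R\<^esub>) \<odot>\<^bsub>Q\<^esub> sym_prod x = \<zero>\<^bsub>Q\<^esub>" ..
  let ?u = "[card (stab x)] \<cdot>\<^bsub>R\<^esub> \<one>\<^bsub>R\<^esub>"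
  have u: "?u \<in> Units R" by (rule card_stab_Units[OF assms(2)])
  then have "sym_prod x = inv\<^bsub>R\<^esub> ?u \<odot>\<^bsub>Q\<^esub> (?u \<odot>\<^bsub>Q\<^esub> sym_prod x)"
    using px by (simp add: Q.smult_assoc1[symmetric])
  then show ?thesis using u by (simp add: z)
qed

text \<open>Stabilizers along an orbit are conjugate, and \<chi> takes commuting values, so it does
  not see conjugation. Since \<open>index_transversal\<close> picks representatives only in orbits
  contained in the index set, this provides one for every index in that set.\<close>

lemma orbit_subset_index_set:
  assumes "i \<in> index_set R d W \<chi> L"
  shows "orbit (perm_group d W) perm_tuple i \<subseteq> index_set R d W \<chi> L"
proof
  fix k assume "k \<in> orbit (perm_group d W) perm_tuple i"
  then obtain \<sigma> where \<sigma>: "\<sigma> \<in> W" "k = perm_tuple \<sigma> i"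
    by (auto simp: orbit_def)
  have inv: "inv' \<sigma> \<circ> \<sigma> = id" "inv' \<sigma> \<in> W"
    using permutes_inv_o(2)[OF W_permutes[OF \<sigma>(1)]] W_inv[OF \<sigma>(1)] by auto
  \<comment> \<open>As \<open>id\<close> is idempotent, \<open>\<chi> id\<close> is an idempotent
    unit and hence one.\<close>
  have id: "\<chi> id = \<one>\<^bsub>R\<^esub>"
    using char_comp[OF W_id W_id] M.Units_l_cancel[of "\<chi> id" "\<chi> id" "\<one>\<^bsub>R\<^esub>"] W_id by simp
  have "\<chi> \<rho> = \<one>\<^bsub>R\<^esub>" if "\<rho> \<in> stab k" for \<rho>
  proof -
    have \<rho>: "\<rho> \<in> W" "perm_tuple \<rho> k = k" using that by (auto simp: stabilizer_def)
    note comp = perm_tuple_comp[OF W_permutes W_permutes]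
    \<comment> \<open>Conjugating \<rho> by \<sigma> brings it back into the stabilizer of
      \<open>i\<close>, where \<chi> is known to be trivial.\<close>
    have "perm_tuple (inv' \<sigma> \<circ> (\<rho> \<circ> \<sigma>)) i = perm_tuple (inv' \<sigma> \<circ> \<sigma>) i"
      using \<sigma> \<rho> inv(2) W_comp by (simp add: comp)
    also have "\<dots> = i" by (simp add: inv(1) perm_tuple_def)
    finally have "inv' \<sigma> \<circ> (\<rho> \<circ> \<sigma>) \<in> stab i"
      using \<sigma>(1) \<rho>(1) inv(2) W_comp by (simp add: stabilizer_def)
    then have "\<chi> (inv' \<sigma> \<circ> (\<rho> \<circ> \<sigma>)) = \<one>\<^bsub>R\<^esub>"
      using assms by (simp add: index_set_def)
    then have "\<chi> \<rho> \<otimes>\<^bsub>R\<^esub> (\<chi> (inv' \<sigma>) \<otimes>\<^bsub>R\<^esub> \<chi> \<sigma>) = \<one>\<^bsub>R\<^esub>"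
      using \<sigma>(1) \<rho>(1) inv(2) W_comp by (simp add: char_comp M.m_lcomm)
    moreover have "\<chi> (inv' \<sigma>) \<otimes>\<^bsub>R\<^esub> \<chi> \<sigma> = \<one>\<^bsub>R\<^esub>"
      using char_comp[OF inv(2) \<sigma>(1)] inv(1) id by simp
    ultimately show ?thesis using \<rho>(1) by simp
  qed
  moreover have "k \<in> tuples d L"
    using assms \<sigma> perm_tuple_closed[OF W_permutes] by (auto simp: index_set_def)
  ultimately show "k \<in> index_set R d W \<chi> L"
    by (simp add: index_set_def)
qed

section \<open>The basis indexed by orbit representatives\<close>

context
  fixes L :: "'l set" and e :: "'l \<Rightarrow> 'e" and J :: "(nat \<Rightarrow> 'l) set"
  assumes basis: "basis_family R M L e" and J: "index_transversal R d W \<chi> L J"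
begin

abbreviation basis_tuple :: "(nat \<Rightarrow> 'l) \<Rightarrow> nat \<Rightarrow> 'e"
  where "basis_tuple i \<equiv> (\<lambda>t\<in>{1..d}. e (i t))"

lemma basis_tuple_closed: "i \<in> tuples d L \<Longrightarrow> basis_tuple i \<in> tuples d (carrier M)"
  using basis by (auto simp: basis_family_def PiE_iff)

lemma perm_basis_tuple:
  assumes "\<sigma> \<in> W"
  shows "perm_tuple \<sigma> (basis_tuple i) = basis_tuple (perm_tuple \<sigma> i)"
  using permutes_in_image[OF permutes_inv[OF W_permutes[OF assms]]]
  by (simp add: perm_tuple_def fun_eq_iff restrict_def del: atLeastAtMost_iff)

lemma index_transversal_orbit:
  assumes "i \<in> index_set R d W \<chi> L"
  shows "\<exists>!j. j \<in> J \<and> j \<in> orbit (perm_group d W) perm_tuple i"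
proof -
  have "orbit (perm_group d W) perm_tuple i \<in> orbits (perm_group d W) (tuples d L) perm_tuple"
    using assms by (auto simp: orbits_def index_set_def)
  then show ?thesis
    using J orbit_subset_index_set[OF assms] by (simp add: index_transversal_def)
qed

lemma index_transversal_unique:
  assumes "i \<in> J" "j \<in> J" "\<sigma> \<in> W" "perm_tuple \<sigma> i = j"
  shows "i = j"
proof -
  have "i \<in> index_set R d W \<chi> L" using J assms(1) by (auto simp: index_transversal_def)
  moreover have "i \<in> orbit (perm_group d W) perm_tuple i"
    using W_id by (force simp: orbit_def perm_tuple_def)
  moreover have "j \<in> orbit (perm_group d W) perm_tuple i"
    using assms(3,4) by (auto simp: orbit_def)
  ultimately show ?thesis
    using index_transversal_orbit assms(1,2) by blast
qed

lemma J_tuples: "j \<in> J \<Longrightarrow> j \<in> tuples d L"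
  using J by (auto simp: index_transversal_def index_set_def)

text \<open>The form is the product of the coordinates named by \<open>j\<close>, symmetrized and
  descended to \<open>Q\<close>. The sum is left unevaluated: it has only zero terms when
  \<open>i\<close> and \<open>j\<close> lie in different orbits, and for \<open>i = j\<close> only
  the stabilizer of \<open>j\<close> contributes.\<close>

lemma dual_form:
  assumes "j \<in> tuples d L"
  obtains g where "module_hom R Q (regular_module R) g"
    "\<And>i. i \<in> tuples d L \<Longrightarrow> g (sym_prod (basis_tuple i)) =
      (\<Oplus>\<^bsub>R\<^esub>\<sigma>\<in>W. if perm_tuple \<sigma> i = j then \<chi> \<sigma> else \<zero>\<^bsub>R\<^esub>)"
proof -
  obtain c where c: "\<And>l. l \<in> L \<Longrightarrow> module_hom R M (regular_module R) (c l)"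
    and c_e: "\<And>l k. \<lbrakk>l \<in> L; k \<in> L\<rbrakk> \<Longrightarrow> c l (e k) = (if k = l then \<one>\<^bsub>R\<^esub> else \<zero>\<^bsub>R\<^esub>)"
    using basis_family_coordinates[OF M.module_axioms basis] by blast
  define \<phi> where "\<phi> = (\<lambda>x. \<Otimes>\<^bsub>R\<^esub>t\<in>{1..d}. c (j t) (x t))"
  have mod: "module R (regular_module R)"
    by (rule module_regular_module[OF M.is_cring])
  have \<phi>: "multilinear_map R M d (regular_module R) \<phi>"
    unfolding \<phi>_def using assms by (intro multilinear_map_prod M.module_axioms c) auto
  have \<phi>_basis: "\<phi> (basis_tuple k) = (if k = j then \<one>\<^bsub>R\<^esub> else \<zero>\<^bsub>R\<^esub>)" if "k \<in> tuples d L" for k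
  proof -
    have "\<phi> (basis_tuple k) = (\<Otimes>\<^bsub>R\<^esub>t\<in>{1..d}. if k t = j t then \<one>\<^bsub>R\<^esub> else \<zero>\<^bsub>R\<^esub>)"
      unfolding \<phi>_def
    proof (intro M.finprod_cong')
      fix t assume t: "t \<in> {1..d}"
      then have "k t \<in> L" "j t \<in> L" using that assms by auto
      then show "c (j t) (basis_tuple k t) = (if k t = j t then \<one>\<^bsub>R\<^esub> else \<zero>\<^bsub>R\<^esub>)"
        using t by (simp add: c_e del: atLeastAtMost_iff)
    qed auto
    \<comment> \<open>Tuples are \<open>undefined\<close> outside \<open>{1..d}\<close>, so
      agreement on that range already gives equality.\<close>
    moreover have "(\<forall>t\<in>{1..d}. k t = j t) \<longleftrightarrow> k = j"
      using PiE_ext[OF that assms] by blast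
    ultimately show ?thesis by (simp only: M.finprod_delta finite_atLeastAtMost)
  qed
  obtain g where g: "module_hom R Q (regular_module R) g"
    "\<And>x. x \<in> tuples d (carrier M) \<Longrightarrow> g (sym_prod x) = symmetrize (regular_module R) \<phi> x"
    using semi_sym_power_lift[OF mod multilinear_symmetrize[OF mod \<phi>]
        symmetrize_perm_tuple[OF mod \<phi>]] by blast
  show thesis
  proof (rule that[OF g(1)])
    fix i assume i: "i \<in> tuples d L"
    have "symmetrize (regular_module R) \<phi> (basis_tuple i) =
        (\<Oplus>\<^bsub>R\<^esub>\<sigma>\<in>W. \<chi> \<sigma> \<otimes>\<^bsub>R\<^esub> \<phi> (perm_tuple \<sigma> (basis_tuple i)))"
      by (simp add: symmetrize_def)
    also have "\<dots> = (\<Oplus>\<^bsub>R\<^esub>\<sigma>\<in>W. if perm_tuple \<sigma> i = j then \<chi> \<sigma> else \<zero>\<^bsub>R\<^esub>)"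
      using perm_tuple_closed[OF W_permutes i]
      by (intro M.R.finsum_cong') (auto simp: perm_basis_tuple \<phi>_basis)
    finally show "g (sym_prod (basis_tuple i)) =
        (\<Oplus>\<^bsub>R\<^esub>\<sigma>\<in>W. if perm_tuple \<sigma> i = j then \<chi> \<sigma> else \<zero>\<^bsub>R\<^esub>)"
      by (simp only: g(2)[OF basis_tuple_closed[OF i]])
  qed
qed

text \<open>Applying the dual form of \<open>j\<close> to a vanishing combination leaves only the
  term at \<open>j\<close>, namely its coefficient times the order of the stabilizer, a
  unit.\<close>

lemma lin_indep_sym_prod:
  assumes "[card W] \<cdot>\<^bsub>R\<^esub> \<one>\<^bsub>R\<^esub> \<in> Units R"
  shows "lin_indep_family R Q J (\<lambda>j. sym_prod (basis_tuple j))"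
  unfolding lin_indep_family_def
proof (intro allI impI ballI, elim conjE)
  fix A c j
  assume A: "finite A" "A \<subseteq> J" and c: "c \<in> A \<rightarrow> carrier R" and j: "j \<in> A"
    and sum: "(\<Oplus>\<^bsub>Q\<^esub>i\<in>A. c i \<odot>\<^bsub>Q\<^esub> sym_prod (basis_tuple i)) = \<zero>\<^bsub>Q\<^esub>"
  have AL: "i \<in> tuples d L" if "i \<in> A" for i using that A(2) J_tuples by blast
  have cl: "sym_prod (basis_tuple i) \<in> carrier Q" if "i \<in> A" for i
    using multilinear_mapD(1)[OF multilinear_sym_prod basis_tuple_closed[OF AL[OF that]]] .
  obtain g where hom: "module_hom R Q (regular_module R) g"
    and g: "\<And>i. i \<in> tuples d L \<Longrightarrow> g (sym_prod (basis_tuple i)) =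
      (\<Oplus>\<^bsub>R\<^esub>\<sigma>\<in>W. if perm_tuple \<sigma> i = j then \<chi> \<sigma> else \<zero>\<^bsub>R\<^esub>)"
    using dual_form[OF AL[OF j]] by blast
  interpret g: module_hom R Q "regular_module R" g by (rule hom)
  let ?u = "[card (stab j)] \<cdot>\<^bsub>R\<^esub> \<one>\<^bsub>R\<^esub>"
  have u: "?u \<in> Units R" by (rule card_stab_Units[OF assms])
  have g_j: "g (sym_prod (basis_tuple j)) = ?u"
  proof -
    \<comment> \<open>Membership in the index set makes \<chi> equal to one on the stabilizer, so
      the surviving terms count its elements.\<close>
    have "j \<in> index_set R d W \<chi> L" using J j A(2) by (auto simp: index_transversal_def)
    then have "(\<Oplus>\<^bsub>R\<^esub>\<sigma>\<in>W. if perm_tuple \<sigma> j = j then \<chi> \<sigma> else \<zero>\<^bsub>R\<^esub>) = (\<Oplus>\<^bsub>R\<^esub>\<sigma>\<in>stab j. \<one>\<^bsub>R\<^esub>)"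
      using finite_W stab_subset[of j]
      by (intro M.R.add.finprod_mono_neutral_cong_right)
        (auto simp: index_set_def stabilizer_def)
    then show ?thesis
      using finite_subset[OF stab_subset[of j] finite_W] by (simp only: g[OF AL[OF j]] M.finsum_one)
  qed
  have g_i: "g (sym_prod (basis_tuple i)) = \<zero>\<^bsub>R\<^esub>" if "i \<in> A" "i \<noteq> j" for i
  proof -
    \<comment> \<open>Distinct elements of \<open>J\<close> lie in distinct orbits, so every term of
      the sum for \<open>i\<close> is zero.\<close>
    have "perm_tuple \<sigma> i \<noteq> j" if "\<sigma> \<in> W" for \<sigma>
      using index_transversal_unique[OF _ _ that, of i j] \<open>i \<in> A\<close> \<open>i \<noteq> j\<close> j A(2) by blast
    then show ?thesis
      unfolding g[OF AL[OF that(1)]] by (intro M.R.add.finprod_one_eqI) simp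
  qed
  have "\<zero>\<^bsub>R\<^esub> = g (\<Oplus>\<^bsub>Q\<^esub>i\<in>A. c i \<odot>\<^bsub>Q\<^esub> sym_prod (basis_tuple i))"
    unfolding sum by simp
  also have "\<dots> = (\<Oplus>\<^bsub>R\<^esub>i\<in>A. g (c i \<odot>\<^bsub>Q\<^esub> sym_prod (basis_tuple i)))"
    using c cl by (subst g.hom_finsum) auto
  also have "\<dots> = (\<Oplus>\<^bsub>R\<^esub>i\<in>A. if j = i then c i \<otimes>\<^bsub>R\<^esub> ?u else \<zero>\<^bsub>R\<^esub>)"
    using c cl u by (intro M.R.finsum_cong') (auto simp: g.hom_smult g_j g_i Pi_iff)
  also have "\<dots> = c j \<otimes>\<^bsub>R\<^esub> ?u"
    using c u j A(1) by (intro M.R.finsum_singleton) auto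
  finally have "c j \<otimes>\<^bsub>R\<^esub> ?u = \<zero>\<^bsub>R\<^esub>" by (rule sym)
  moreover have "c j = c j \<otimes>\<^bsub>R\<^esub> ?u \<otimes>\<^bsub>R\<^esub> inv\<^bsub>R\<^esub> ?u"
    using funcset_mem[OF c j] u by (simp add: M.m_assoc M.Units_closed)
  ultimately show "c j = \<zero>\<^bsub>R\<^esub>" using u by simp
qed

lemma span_sym_prod:
  assumes "domain R" "[card W] \<cdot>\<^bsub>R\<^esub> \<one>\<^bsub>R\<^esub> \<in> Units R"
  shows "submodule_span R Q ((\<lambda>j. sym_prod (basis_tuple j)) ` J) = carrier Q"
proof
  interpret Q: module R Q by (rule module_Q)
  let ?B = "(\<lambda>j. sym_prod (basis_tuple j)) ` J"
  let ?S = "submodule_span R Q ?B"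
  have closed: "sym_prod (basis_tuple i) \<in> carrier Q" if "i \<in> tuples d L" for i
    using multilinear_mapD(1)[OF multilinear_sym_prod basis_tuple_closed[OF that]] .
  have S: "submodule ?S R Q"
    using closed J_tuples by (intro submodule_submodule_span[OF module_Q]) auto
  then show "?S \<subseteq> carrier Q" by (rule Q.submoduleE(1))
  \<comment> \<open>An index in the index set is moved to the representative of its orbit at the
    cost of a unit factor; for any other index the product is zero.\<close>
  have basis_S: "sym_prod (basis_tuple i) \<in> ?S" if i: "i \<in> tuples d L" for i
  proof (cases "i \<in> index_set R d W \<chi> L")
    case True
    then obtain \<sigma> where \<sigma>: "\<sigma> \<in> W" "perm_tuple \<sigma> i \<in> J"
      using index_transversal_orbit[OF True] by (auto simp: orbit_def)
    have "sym_prod (basis_tuple (perm_tuple \<sigma> i)) = inv\<^bsub>R\<^esub> \<chi> \<sigma> \<odot>\<^bsub>Q\<^esub> sym_prod (basis_tuple i)"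
      using sym_prod_perm_tuple[OF \<sigma>(1) basis_tuple_closed[OF i]]
      by (simp only: perm_basis_tuple[OF \<sigma>(1)])
    then have "sym_prod (basis_tuple i) =
        \<chi> \<sigma> \<odot>\<^bsub>Q\<^esub> sym_prod (basis_tuple (perm_tuple \<sigma> i))"
      using closed[OF i] \<sigma>(1) by (simp add: Q.smult_assoc1[symmetric])
    moreover have "sym_prod (basis_tuple (perm_tuple \<sigma> i)) \<in> ?S"
      using \<sigma>(2) by (intro subsetD[OF submodule_span_superset] imageI)
    ultimately show ?thesis
      using Q.submoduleE(4)[OF S] \<sigma>(1) by simp
  next
    case False
    then obtain \<sigma> where "\<sigma> \<in> stab i" "\<chi> \<sigma> \<noteq> \<one>\<^bsub>R\<^esub>"
      using i by (auto simp: index_set_def)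
    then have "sym_prod (basis_tuple i) = \<zero>\<^bsub>Q\<^esub>"
      by (intro sym_prod_eq_zero[OF assms basis_tuple_closed[OF i]])
        (auto simp: stabilizer_def perm_basis_tuple)
    then show ?thesis
      using subgroup.one_closed[OF submodule.axioms(1)[OF S]] by simp
  qed
  have gen_S: "sym_prod y \<in> ?S" if y: "y \<in> tuples d (e ` L)" for y
  proof -
    \<comment> \<open>Preimages under \<open>e\<close> are chosen entrywise, exhibiting
      \<open>y\<close> as a basis tuple; the restriction makes the index tuple extensional.\<close>
    let ?i = "\<lambda>t\<in>{1..d}. inv_into L e (y t)"
    have "?i \<in> tuples d L"
      using y by (auto simp: PiE_iff inv_into_into)
    moreover have "y = basis_tuple ?i"
      using y by (auto simp: fun_eq_iff PiE_iff extensional_def f_inv_into_f)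
    ultimately show ?thesis using basis_S by metis
  qed
  have span_L: "submodule_span R M (e ` L) = carrier M"
    using basis by (simp add: basis_family_def)
  show "carrier Q \<subseteq> ?S"
  proof
    fix z assume "z \<in> carrier Q"
    then show "z \<in> ?S"
    \<comment> \<open>It is enough to treat the products of arbitrary tuples, and multilinearity
      reduces these to tuples with entries in the basis.\<close>
    proof (rule Q_generated[OF S, rotated])
      fix x assume x: "x \<in> tuples d (carrier M)"
      show "sym_prod x \<in> ?S"
        by (rule multilinear_map_in_submodule[OF M.module_axioms module_Q multilinear_sym_prod S
              span_L gen_S x])
    qed
  qed
qed

lemma basis_family_sym_prod:
  assumes "domain R" "[card W] \<cdot>\<^bsub>R\<^esub> \<one>\<^bsub>R\<^esub> \<in> Units R"
  shows "basis_family R Q J (\<lambda>j. sym_prod (basis_tuple j))"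
  unfolding basis_family_def
proof (intro conjI Pi_I)
  fix j assume "j \<in> J"
  then show "sym_prod (basis_tuple j) \<in> carrier Q"
    by (intro multilinear_mapD(1)[OF multilinear_sym_prod] basis_tuple_closed J_tuples)
qed (fact lin_indep_sym_prod[OF assms(2)] span_sym_prod[OF assms])+

end

end

theorem corollary6:
  fixes K :: "('k, 'r) ring_scheme"
    and E :: "('k, 'e, 'm) module_scheme"
    and L :: "'l set" and e :: "'l \<Rightarrow> 'e"
    and d :: nat
    and W :: "(nat \<Rightarrow> nat) set" and \<chi> :: "(nat \<Rightarrow> nat) \<Rightarrow> 'k"
    and J :: "(nat \<Rightarrow> 'l) set"
  assumes "domain K"
    and "d \<ge> 1"
    and "subgroup W (sym_group d)"
    and "[card W] \<cdot>\<^bsub>K\<^esub> \<one>\<^bsub>K\<^esub> \<in> Units K"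
    and "\<chi> \<in> hom (perm_group d W) (units_of K)"
    and "module K E"
    and "basis_family K E L e"
    and "index_transversal K d W \<chi> L J"
  shows "module K (semi_sym_power K E d W \<chi>) \<and>
    basis_family K (semi_sym_power K E d W \<chi>) J
      (\<lambda>j. semi_sym_prod K E d W \<chi> (\<lambda>t\<in>{1..d}. e (j t)))"
proof -
  interpret semi_symmetric K E d W \<chi>
    using assms(3,5,6) by (intro semi_symmetric.intro semi_symmetric_axioms.intro)
  show ?thesis
    using module_Q basis_family_sym_prod[OF assms(7,8,1,4)] by blast
qed

end
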